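(* Let $\{S_i\}_{i=1}^m$ be an SS-IFS in $\mathbb{R}^d$ with attractor $K\subseteq\mathbb{R}^d$ containing at least two points, let $t=\dim_H(K)$, and let $L:\mathbb{R}^d\to\mathbb{R}^{d_2}$ be a linear map. Then (i) $\mathcal{H}^t(L(K))=\mathcal{H}^t_\infty(L(K))$; (ii) for every $\varepsilon>0$ there exists $\delta>0$ such that for every linear map $L_2:\mathbb{R}^d\to\mathbb{R}^{d_2}$ with $\|L-L_2\|<\delta$ we have $\mathcal{H}^t(L_2(K))\le\mathcal{H}^t(L(K))+\varepsilon$.
   Context: $\dim_H$ denotes Hausdorff dimension and $\|\cdot\|$ the Euclidean operator norm. For $0<\eta\le\infty$, $\mathcal{H}^t_\eta(H)=\inf\{\sum_{i=1}^\infty\mathrm{diam}(U_i)^t: H\subseteq\bigcup_{i=1}^\infty U_i,\ \mathrm{diam}(U_i)\le\eta\}$ (no normalizing constant); $\mathcal{H}^t=\lim_{\eta\to0}\mathcal{H}^t_\eta$ is $t$-dimensional Hausdorff measure and $\mathcal{H}^t_\infty$ (no restriction on diameters) is the Hausdorff content. A self-similar iterated function system (SS-IFS) in $\mathbb{R}^d$ is a finite collection $\{S_i\}_{i=1}^m$ of contracting similarities of $\mathbb{R}^d$. Its attractor is the unique nonempty compact $K$ with $K=\bigcup_{i=1}^m S_i(K)$. No separation condition is assumed. *)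

theory Defs
  imports "HOL-Analysis.Analysis"
begin

(* The library's diameter is real-valued and carries no information on unbounded sets;
   coverings by unbounded sets must be allowed in the Hausdorff content. *)
definition ediam :: "'a::metric_space set \<Rightarrow> ennreal" where
  "ediam U = (SUP x\<in>U. SUP y\<in>U. ennreal (dist x y))"

(* diam(U)^t for t \<ge> 0. The library has no real powers of ennreal. Conventions: the empty set
   contributes 0 for every t, and diam(U)^0 = 1 for nonempty U (so that the case t = 0 gives
   counting measure), and \<infinity>^t = \<infinity> for t > 0. *)
definition diam_pow :: "real \<Rightarrow> 'a::metric_space set \<Rightarrow> ennreal" where
  "diam_pow t U =
     (if U = {} then 0
      else if t = 0 then 1
      else if ediam U = \<infinity> then \<infinity>
      else ennreal (enn2real (ediam U) powr t))"

definition hausdorff_pre :: "real \<Rightarrow> ennreal \<Rightarrow> 'a::metric_space set \<Rightarrow> ennreal" where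
  "hausdorff_pre t \<eta> H =
     (INF U \<in> {U :: nat \<Rightarrow> 'a set. H \<subseteq> (\<Union>i. U i) \<and> (\<forall>i. ediam (U i) \<le> \<eta>)}.
        \<Sum>i. diam_pow t (U i))"

definition hausdorff_content :: "real \<Rightarrow> 'a::metric_space set \<Rightarrow> ennreal" where
  "hausdorff_content t H = hausdorff_pre t \<infinity> H"

definition hausdorff_measure :: "real \<Rightarrow> 'a::metric_space set \<Rightarrow> ennreal" where
  "hausdorff_measure t H = Lim (at_right 0) (\<lambda>\<eta>. hausdorff_pre t \<eta> H)"

(* Extended-valued, since the dimension may be infinite in a general metric space; in R^d it is
   at most d, so that enn2real loses nothing there. *)
definition hausdorff_dim :: "'a::metric_space set \<Rightarrow> ennreal" where
  "hausdorff_dim H = (INF s \<in> {s. 0 \<le> s \<and> hausdorff_measure s H = 0}. ennreal s)"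

definition contracting_similarity :: "('a::metric_space \<Rightarrow> 'a) \<Rightarrow> bool" where
  "contracting_similarity S \<longleftrightarrow>
     (\<exists>r::real. 0 < r \<and> r < 1 \<and> (\<forall>x y. dist (S x) (S y) = r * dist x y))"

definition ss_ifs :: "nat \<Rightarrow> (nat \<Rightarrow> 'a::metric_space \<Rightarrow> 'a) \<Rightarrow> bool" where
  "ss_ifs m S \<longleftrightarrow> 1 \<le> m \<and> (\<forall>i\<in>{1..m}. contracting_similarity (S i))"

(* In a complete space there is exactly one such K (Hutchinson), so this predicate
   determines the attractor. *)
definition is_attractor :: "nat \<Rightarrow> (nat \<Rightarrow> 'a::metric_space \<Rightarrow> 'a) \<Rightarrow> 'a set \<Rightarrow> bool" where
  "is_attractor m S K \<longleftrightarrow> K \<noteq> {} \<and> compact K \<and> K = (\<Union>i\<in>{1..m}. S i ` K)"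

lemma hausdorff_pre_antimono:
  assumes "\<eta> \<le> \<eta>'"
  shows "hausdorff_pre t \<eta>' H \<le> hausdorff_pre t \<eta> H"
  unfolding hausdorff_pre_def
  by (rule INF_superset_mono) (use assms order_trans in blast)+

(* The limit defining hausdorff_measure exists. *)
lemma hausdorff_pre_tendsto:
  "((\<lambda>\<eta>. hausdorff_pre t \<eta> H) \<longlongrightarrow> (SUP \<eta>\<in>{0<..}. hausdorff_pre t \<eta> H)) (at_right 0)"
proof (rule order_tendstoI)
  fix a assume "a < (SUP \<eta>\<in>{0<..}. hausdorff_pre t \<eta> H)"
  then obtain e where e: "0 < e" "a < hausdorff_pre t e H"
    by (auto simp: less_SUP_iff)
  have "a < hausdorff_pre t \<eta> H" if "\<eta> < e" for \<eta>
    using e(2) hausdorff_pre_antimono[of \<eta> e t H] that by (meson less_imp_le order_less_le_trans)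
  then show "\<forall>\<^sub>F \<eta> in at_right 0. a < hausdorff_pre t \<eta> H"
    using e(1)
    by (auto simp: eventually_at_right[OF e(1)])
next
  fix a assume a: "(SUP \<eta>\<in>{0<..}. hausdorff_pre t \<eta> H) < a"
  have "hausdorff_pre t \<eta> H < a" if "0 < \<eta>" for \<eta>
    using a that by (metis SUP_upper greaterThan_iff order_le_less_trans)
  then show "\<forall>\<^sub>F \<eta> in at_right 0. hausdorff_pre t \<eta> H < a"
    by (auto simp: eventually_at_right[of "0::ennreal" 1] intro!: exI[of _ 1])
qed

lemma hausdorff_measure_eq_SUP:
  "hausdorff_measure t H = (SUP \<eta>\<in>{0<..}. hausdorff_pre t \<eta> H)"
  unfolding hausdorff_measure_def
proof (rule tendsto_Lim[OF _ hausdorff_pre_tendsto])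
  show "at_right (0::ennreal) \<noteq> bot"
    unfolding trivial_limit_def eventually_at_right[of "0::ennreal" 1, simplified]
    by (metis dense)
qed

end

(* The key step is H^t(L(K)) \<le> H^t_\<infinity>(L(K)). By compactness, a nearly optimal cover of L(K) may be
   taken finite and open; it then also covers L(A(K)) for every isometry A near the identity, so
   after scaling by r_w it covers L(S_w(K)) whenever the orthogonal part of S_w is near the
   identity. A Vitali argument selects disjoint pieces S_w(K) of this kind such that K is exhausted
   by finitely many of them and by balls comparable to the remaining ones. Such pieces exist near
   every point, because each orthogonal part becomes nearly trivial after appending a word from a
   suitable finite set. Disjointness forces the sum of the r_w^t to be at most 1: otherwise the
   similarities S_w would generate a subset of K of dimension larger than t. Hence no finiteness or
   positivity of H^t(K) is needed. Part (ii) follows from (i), since the finite open cover of L(K)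
   also covers L_2(K) for L_2 near L. *)

theory Submission
  imports Defs
begin

section \<open>Coverings and Hausdorff content\<close>

text \<open>Overlaps may be so heavy that \<open>K\<close> has t-dimensional measure 0, so its
  Hausdorff measure cannot certify that the leftover of a Vitali selection is negligible. The series
  of the r_w^t takes this role, and the bound 1 on its sums is used twice: copies of one cover of
  L(K), scaled by the r_w, cost together at most as much as that cover, and the balls around the
  remaining pieces cost a constant times a tail of the series. Rotations must be controlled because
  L(S_w(x)) = L(S_w(0)) + r_w L(O_w x), and a cover of L(K) says nothing about L(O_w(K)) for a
  general orthogonal O_w. Small ratios r_w turn covering sets of any bounded size into sets of
  diameter below \<eta>, which is how the content comes to bound the measure.\<close>

lemma ediam_le_iff: "ediam U \<le> d \<longleftrightarrow> (\<forall>x\<in>U. \<forall>y\<in>U. ennreal (dist x y) \<le> d)"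
  by (simp add: ediam_def SUP_le_iff)

lemma dist_le_ediam: "x \<in> U \<Longrightarrow> y \<in> U \<Longrightarrow> ennreal (dist x y) \<le> ediam U"
  using ediam_le_iff by blast

lemma ediam_empty: "ediam {} = 0"
  by (simp add: ediam_def bot_ennreal)

lemma ediam_mono: "U \<subseteq> V \<Longrightarrow> ediam U \<le> ediam V"
  unfolding ediam_le_iff by (auto intro: dist_le_ediam)

lemma ediam_image_similarity:
  assumes "\<And>x y. dist (f x) (f y) = r * dist x y" and "0 \<le> r"
  shows "ediam (f ` U) = ennreal r * ediam U"
  by (simp add: ediam_def assms ennreal_mult SUP_mult_left_ennreal image_image)

lemma diam_pow_mono:
  assumes "U \<subseteq> V" and "0 \<le> t"
  shows "diam_pow t U \<le> diam_pow t V"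
proof -
  have "ediam U \<le> ediam V" by (rule ediam_mono[OF assms(1)])
  then show ?thesis
    using assms by (auto simp: diam_pow_def top_unique less_top intro!: ennreal_leI powr_mono2 enn2real_mono)
qed

lemma diam_pow_image_similarity:
  assumes "\<And>x y. dist (f x) (f y) = r * dist x y" and "0 < r"
  shows "diam_pow t (f ` U) = ennreal (r powr t) * diam_pow t U"
proof -
  have "ediam (f ` U) = ennreal r * ediam U"
    using ediam_image_similarity assms by (metis less_imp_le)
  then show ?thesis
    using assms(2) by (auto simp: diam_pow_def ennreal_mult_eq_top_iff ennreal_mult_top
       enn2real_mult powr_mult ennreal_mult)
qed

lemma diam_pow_le:
  assumes "ediam U \<le> ennreal d" and "0 < t" and "0 \<le> d"
  shows "diam_pow t U \<le> ennreal (d powr t)"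
proof -
  have "enn2real (ediam U) \<le> d" using assms enn2real_leI by blast
  then show ?thesis
    using assms by (auto simp: diam_pow_def top_unique intro!: ennreal_leI powr_mono2)
qed

lemma dist_powr_le_diam_pow:
  assumes "x \<in> U" and "y \<in> U" and "0 < t" and "0 \<le> d" and "d \<le> dist x y"
  shows "ennreal (d powr t) \<le> diam_pow t U"
proof (cases "ediam U = \<infinity>")
  case True
  then show ?thesis using assms by (auto simp: diam_pow_def)
next
  case False
  have "ennreal d \<le> ediam U"
    using dist_le_ediam[OF assms(1,2)] assms(5) by (meson ennreal_leI order_trans)
  then have "d \<le> enn2real (ediam U)"
    using False assms(4) by (metis enn2real_ennreal enn2real_mono infinity_ennreal_def less_top)
  then show ?thesis
    using assms False by (auto simp: diam_pow_def intro!: ennreal_leI powr_mono2)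
qed

text \<open>The power x^t is right-continuous at the diameter of \<open>U\<close>, so a thin open
  neighbourhood costs little more. For nonempty \<open>U\<close> with \<open>t = 0\<close> or
  infinite diameter, the whole space costs no more than \<open>U\<close>.\<close>

lemma diam_pow_open_superset:
  assumes "0 \<le> t" and "0 < e"
  obtains V where "open V" and "U \<subseteq> V" and "diam_pow t V \<le> diam_pow t U + ennreal e"
proof -
  consider "U = {}" | "U \<noteq> {}" "t = 0" | "U \<noteq> {}" "t > 0" "ediam U = \<infinity>"
    | "U \<noteq> {}" "t > 0" "ediam U \<noteq> \<infinity>" using assms by linarith
  then show thesis
  proof cases
    case 1 then show thesis using that[of "{}"] by simp
  next
    case 2 then show thesis using that[of UNIV] by (simp add: diam_pow_def)
  next
    case 3 then show thesis using that[of UNIV] by (simp add: diam_pow_def)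
  next
    case 4
    define d where "d = enn2real (ediam U)"
    have d: "ediam U = ennreal d" "0 \<le> d" using 4 by (auto simp: d_def less_top)
    have "((\<lambda>x. x powr t) \<longlongrightarrow> d powr t) (at_right d)"
    proof (rule tendsto_powr'[OF tendsto_ident_at tendsto_const])
      have "\<forall>\<^sub>F x in at_right d. 0 \<le> x"
        using eventually_at_right_less[of d] by eventually_elim (use d in linarith)
      then show "d \<noteq> 0 \<or> 0 < t \<and> (\<forall>\<^sub>F x in at_right d. 0 \<le> x)" using 4 by simp
    qed
    then have "\<forall>\<^sub>F x in at_right d. x powr t < d powr t + e"
      by (rule order_tendstoD) (use assms in simp)
    then obtain b where b: "b > d" "\<And>x. d < x \<Longrightarrow> x < b \<Longrightarrow> x powr t < d powr t + e"
      unfolding eventually_at_right_field by blast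
    \<comment> \<open>Thickening by \<open>\<rho>\<close> adds at most
      \<open>2 * \<rho> = (b - d) / 2\<close> to the diameter, which stays below
      \<open>b\<close>.\<close>
    define \<rho> where "\<rho> = (b - d) / 4"
    have \<rho>: "0 < \<rho>" "d + 2 * \<rho> < b" using b by (auto simp: \<rho>_def field_simps)
    let ?V = "\<Union>x\<in>U. ball x \<rho>"
    have "ediam ?V \<le> ennreal (d + 2 * \<rho>)"
      unfolding ediam_le_iff
    proof safe
      fix x y p q assume h: "p \<in> U" "q \<in> U" "x \<in> ball p \<rho>" "y \<in> ball q \<rho>"
      have "ennreal (dist p q) \<le> ennreal d" using h dist_le_ediam d by metis
      then have "dist p q \<le> d" using d by simp
      moreover have "dist x y \<le> dist p x + dist p q + dist q y"
        by (metis add.commute add_le_cancel_left add_mono_thms_linordered_semiring(3) dist_commute dist_triangle dist_triangle2 order_trans)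
      ultimately show "ennreal (dist x y) \<le> ennreal (d + 2 * \<rho>)"
        using h by (intro ennreal_leI) auto
    qed
    then have "diam_pow t ?V \<le> ennreal ((d + 2 * \<rho>) powr t)"
      using diam_pow_le d 4 \<rho> by (metis add_nonneg_nonneg less_imp_le mult_nonneg_nonneg zero_le_numeral)
    also have "\<dots> \<le> ennreal (d powr t + e)" using b \<rho> by (intro ennreal_leI less_imp_le) auto
    also have "\<dots> = diam_pow t U + ennreal e"
      using 4 assms by (simp add: diam_pow_def d_def)
    finally show thesis using \<rho> by (intro that[of ?V]) auto
  qed
qed

lemma hausdorff_pre_le_of_finite_sums:
  assumes "countable I" and "H \<subseteq> (\<Union>i\<in>I. U i)" and "\<And>i. i \<in> I \<Longrightarrow> ediam (U i) \<le> \<eta>"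
    and "\<And>J. finite J \<Longrightarrow> J \<subseteq> I \<Longrightarrow> (\<Sum>i\<in>J. diam_pow t (U i)) \<le> a"
  shows "hausdorff_pre t \<eta> H \<le> a"
proof -
  define V where "V n = (if n \<in> to_nat_on I ` I then U (from_nat_into I n) else {})" for n
  have V: "V (to_nat_on I i) = U i" if "i \<in> I" for i
    using that assms(1) by (auto simp: V_def)
  have "H \<subseteq> (\<Union>n. V n)" using assms(2) V by blast
  moreover have "ediam (V n) \<le> \<eta>" for n
    using V assms(3) by (cases "n \<in> to_nat_on I ` I") (auto simp: V_def ediam_empty)
  ultimately have "hausdorff_pre t \<eta> H \<le> (\<Sum>n. diam_pow t (V n))"
    unfolding hausdorff_pre_def by (intro INF_lower) auto
  also have "\<dots> \<le> a"
  proof (rule suminf_le_const[OF summableI])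
    fix N
    define J where "J = {i\<in>I. to_nat_on I i < N}"
    have inj: "inj_on (to_nat_on I) J"
      using inj_on_to_nat_on[OF assms(1)] by (rule inj_on_subset) (auto simp: J_def)
    have fin: "finite J"
      by (rule finite_imageD[OF _ inj]) (rule finite_subset[of _ "{..<N}"], auto simp: J_def)
    have "(\<Sum>n<N. diam_pow t (V n)) = (\<Sum>n\<in>to_nat_on I ` J. diam_pow t (V n))"
      by (rule sum.mono_neutral_right) (auto simp: J_def V_def diam_pow_def)
    also have "\<dots> = (\<Sum>i\<in>J. diam_pow t (U i))"
      by (subst sum.reindex[OF inj]) (auto simp: J_def V intro!: sum.cong)
    also have "\<dots> \<le> a" using fin by (intro assms(4)) (auto simp: J_def)
    finally show "(\<Sum>n<N. diam_pow t (V n)) \<le> a" .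
  qed
  finally show ?thesis .
qed

lemma less_add_ennreal: "a < top \<Longrightarrow> 0 < e \<Longrightarrow> a < a + ennreal e"
  by (cases a) (auto simp: ennreal_less_iff simp flip: ennreal_plus)

lemma hausdorff_pre_mono: "A \<subseteq> B \<Longrightarrow> hausdorff_pre t \<eta> A \<le> hausdorff_pre t \<eta> B"
  unfolding hausdorff_pre_def by (rule INF_superset_mono) auto

lemma hausdorff_pre_Un: "hausdorff_pre t \<eta> (A \<union> B) \<le> hausdorff_pre t \<eta> A + hausdorff_pre t \<eta> B"
proof -
  have "hausdorff_pre t \<eta> (A \<union> B) \<le> (\<Sum>i. diam_pow t (U i)) + (\<Sum>i. diam_pow t (V i))"
    if U: "A \<subseteq> (\<Union>i. U i)" "\<And>i. ediam (U i) \<le> \<eta>"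
      and V: "B \<subseteq> (\<Union>i. V i)" "\<And>i. ediam (V i) \<le> \<eta>" for U V :: "nat \<Rightarrow> 'a set"
  proof (rule hausdorff_pre_le_of_finite_sums[where I = UNIV and U = "case_sum U V"])
    show "A \<union> B \<subseteq> (\<Union>i\<in>UNIV. case_sum U V i)"
      using U V by (auto simp: UNIV_sum)
    show "ediam (case_sum U V i) \<le> \<eta>" for i using U V by (cases i) auto
    fix J :: "(nat + nat) set" assume "finite J"
    define J1 where "J1 = Inl -` J" define J2 where "J2 = Inr -` J"
    have J: "J = Inl ` J1 \<union> Inr ` J2"
    proof (rule set_eqI)
      show "i \<in> J \<longleftrightarrow> i \<in> Inl ` J1 \<union> Inr ` J2" for i
        by (cases i) (auto simp: J1_def J2_def)
    qed
    have fin: "finite J1" "finite J2"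
      using \<open>finite J\<close> by (auto simp: J1_def J2_def intro!: finite_vimageI)
    have "(\<Sum>i\<in>J. diam_pow t (case_sum U V i)) = (\<Sum>i\<in>J1. diam_pow t (U i)) + (\<Sum>i\<in>J2. diam_pow t (V i))"
      unfolding J by (subst sum.union_disjoint) (auto simp: fin sum.reindex)
    also have "\<dots> \<le> (\<Sum>i. diam_pow t (U i)) + (\<Sum>i. diam_pow t (V i))"
      by (intro add_mono sum_le_suminf) (auto simp: fin)
    finally show "(\<Sum>i\<in>J. diam_pow t (case_sum U V i)) \<le> \<dots>" .
  qed auto
  note bound = this
  show ?thesis
  proof (rule ennreal_le_epsilon)
    fix e :: real
    assume fin: "hausdorff_pre t \<eta> A + hausdorff_pre t \<eta> B < top" and "0 < e"
    have "hausdorff_pre t \<eta> A < hausdorff_pre t \<eta> A + ennreal (e / 2)"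
      using fin \<open>0 < e\<close> by (intro less_add_ennreal) auto
    then obtain U where U: "A \<subseteq> (\<Union>i. U i)" "\<And>i. ediam (U i) \<le> \<eta>"
        "(\<Sum>i. diam_pow t (U i)) < hausdorff_pre t \<eta> A + ennreal (e / 2)"
      by (subst (asm) hausdorff_pre_def) (auto simp: INF_less_iff)
    have "hausdorff_pre t \<eta> B < hausdorff_pre t \<eta> B + ennreal (e / 2)"
      using fin \<open>0 < e\<close> by (intro less_add_ennreal) auto
    then obtain V where V: "B \<subseteq> (\<Union>i. V i)" "\<And>i. ediam (V i) \<le> \<eta>"
        "(\<Sum>i. diam_pow t (V i)) < hausdorff_pre t \<eta> B + ennreal (e / 2)"
      by (subst (asm) hausdorff_pre_def) (auto simp: INF_less_iff)
    have "hausdorff_pre t \<eta> (A \<union> B)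
        \<le> (hausdorff_pre t \<eta> A + ennreal (e / 2)) + (hausdorff_pre t \<eta> B + ennreal (e / 2))"
      using bound[OF U(1,2) V(1,2)] add_mono[OF less_imp_le[OF U(3)] less_imp_le[OF V(3)]] by simp
    also have "\<dots> = hausdorff_pre t \<eta> A + hausdorff_pre t \<eta> B + (ennreal (e / 2) + ennreal (e / 2))"
      by (simp add: ac_simps)
    also have "ennreal (e / 2) + ennreal (e / 2) = ennreal e"
      using \<open>0 < e\<close> by (simp flip: ennreal_plus)
    finally show "hausdorff_pre t \<eta> (A \<union> B) \<le> hausdorff_pre t \<eta> A + hausdorff_pre t \<eta> B + ennreal e" .
  qed
qed

lemma hausdorff_content_le_measure: "hausdorff_content t H \<le> hausdorff_measure t H"
proof -
  have "hausdorff_content t H \<le> hausdorff_pre t 1 H"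
    unfolding hausdorff_content_def by (rule hausdorff_pre_antimono) simp
  also have "\<dots> \<le> hausdorff_measure t H"
    unfolding hausdorff_measure_eq_SUP by (rule SUP_upper) simp
  finally show ?thesis .
qed

text \<open>The strict inequality leaves a positive slack \<open>e\<close>. Enlarging the i-th set
  to an open one at cost e/2^(i+1) stays within it, and compactness then discards all but finitely
  many sets.\<close>

lemma finite_open_cover_of_content_less:
  assumes "compact H" and "0 \<le> t" and "hausdorff_content t H < a"
  obtains I :: "nat set" and U where "finite I" and "\<And>i. i \<in> I \<Longrightarrow> open (U i)"
    and "H \<subseteq> (\<Union>i\<in>I. U i)" and "(\<Sum>i\<in>I. diam_pow t (U i)) < a"
proof -
  obtain U :: "nat \<Rightarrow> 'a set" where U: "H \<subseteq> (\<Union>i. U i)" "(\<Sum>i. diam_pow t (U i)) < a"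
    using assms(3) unfolding hausdorff_content_def hausdorff_pre_def INF_less_iff by auto
  obtain b where b: "(\<Sum>i. diam_pow t (U i)) < b" "b < a" using U dense by blast
  obtain e where e: "0 < e" "(\<Sum>i. diam_pow t (U i)) + ennreal e \<le> b"
  proof -
    define e where "e = b - (\<Sum>i. diam_pow t (U i))"
    have "0 < e" unfolding e_def using b(1) by (rule diff_gr0_ennreal)
    moreover have "e + (\<Sum>i. diam_pow t (U i)) = b"
      unfolding e_def using b(1) by (intro diff_add_cancel_ennreal less_imp_le)
    moreover have "e < top" unfolding e_def using b(2)
      by (meson diff_le_self_ennreal le_less_trans less_le_trans top_greatest)
    ultimately show thesis using that[of "enn2real e"] by (auto simp: enn2real_positive_iff add.commute)
  qed
  have "\<exists>V. open V \<and> U i \<subseteq> V \<and> diam_pow t V \<le> diam_pow t (U i) + ennreal (e * (1/2) ^ Suc i)" for i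
  proof -
    have "0 < e * (1/2) ^ Suc i" using e by simp
    from diam_pow_open_superset[OF assms(2) this] show ?thesis by metis
  qed
  then obtain V where V: "\<And>i. open (V i)" "\<And>i. U i \<subseteq> V i"
    "\<And>i. diam_pow t (V i) \<le> diam_pow t (U i) + ennreal (e * (1/2) ^ Suc i)" by metis
  have cov: "H \<subseteq> (\<Union>i\<in>UNIV. V i)"
    by (rule order_trans[OF U(1)]) (rule UN_mono[OF order_refl V(2)])
  obtain I where I: "finite I" "H \<subseteq> (\<Union>i\<in>I. V i)"
    by (rule compactE_image[OF assms(1) V(1) cov])
  have "(\<lambda>i. e * (1/2) ^ Suc i) sums (e * 1)"
    by (intro sums_mult power_half_series)
  then have "(\<lambda>i. e * (1/2) ^ Suc i) sums e" by simp
  then have half: "(\<Sum>i. ennreal (e * (1/2) ^ Suc i)) = ennreal e"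
    by (rule suminf_ennreal_eq[rotated]) (use e in simp)
  have "(\<Sum>i\<in>I. diam_pow t (V i)) \<le> (\<Sum>i. diam_pow t (V i))"
    by (rule sum_le_suminf) (auto simp: I)
  also have "\<dots> \<le> (\<Sum>i. diam_pow t (U i) + ennreal (e * (1/2) ^ Suc i))"
    by (intro suminf_le V) auto
  also have "\<dots> = (\<Sum>i. diam_pow t (U i)) + ennreal e"
    unfolding half[symmetric] by (subst suminf_add) auto
  also have "\<dots> < a" using e b by simp
  finally show thesis using that[of I V] I V by blast
qed

text \<open>Positivity comes from the gap \<open>\<delta>\<close> between the copies: every finite
  cover costs at least \<delta>^s, or at least 1 if \<open>s = 0\<close>. The argument works with
  covers of \<open>K\<close> itself, in place of the subset generated by the copies and a measure on
  it.\<close>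

lemma content_pos_of_disjoint_copies:
  fixes f :: "'i \<Rightarrow> 'a::heine_borel \<Rightarrow> 'a"
  assumes "finite J" and K: "compact K" "K \<noteq> {}"
    and sim: "\<And>j x y. j \<in> J \<Longrightarrow> dist (f j x) (f j y) = \<rho> j * dist x y"
    and \<rho>: "\<And>j. j \<in> J \<Longrightarrow> 0 < \<rho> j" "\<And>j. j \<in> J \<Longrightarrow> \<rho> j < 1"
    and sub: "\<And>j. j \<in> J \<Longrightarrow> f j ` K \<subseteq> K"
    and disj: "\<And>j k. j \<in> J \<Longrightarrow> k \<in> J \<Longrightarrow> j \<noteq> k \<Longrightarrow> f j ` K \<inter> f k ` K = {}"
    and s: "0 \<le> s" "1 \<le> (\<Sum>j\<in>J. \<rho> j powr s)"
  shows "0 < hausdorff_content s K"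
proof -
  have comp: "compact (f j ` K)" if "j \<in> J" for j
  proof (rule compact_continuous_image[OF _ K(1)])
    have "(\<rho> j)-lipschitz_on K (f j)"
      using that sim \<rho>(1)[OF that] by (intro lipschitz_onI) auto
    then show "continuous_on K (f j)" by (rule lipschitz_on_continuous_on)
  qed
  have "\<exists>d>0. \<forall>x\<in>f j ` K. \<forall>y\<in>f k ` K. d \<le> dist x y" if "j \<in> J" "k \<in> J" "j \<noteq> k" for j k
    using separate_compact_closed[OF comp[OF that(1)] compact_imp_closed[OF comp[OF that(2)]] disj[OF that]] .
  then obtain d where d: "\<And>j k. j \<in> J \<Longrightarrow> k \<in> J \<Longrightarrow> j \<noteq> k \<Longrightarrow> 0 < d j k \<and>
      (\<forall>x\<in>f j ` K. \<forall>y\<in>f k ` K. d j k \<le> dist x y)" by metis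
  \<comment> \<open>The entry 1 is a default for the case without pairs of distinct copies.\<close>
  define \<delta> where "\<delta> = Min (insert 1 ((\<lambda>(j,k). d j k) ` {(j,k)\<in>J\<times>J. j \<noteq> k}))"
  have fin: "finite (insert 1 ((\<lambda>(j,k). d j k) ` {(j,k)\<in>J\<times>J. j \<noteq> k}))"
    using assms(1) by (auto intro!: finite_imageI intro: finite_subset[of _ "J \<times> J"])
  have \<delta>: "0 < \<delta>" unfolding \<delta>_def using fin d by (subst Min_gr_iff) auto
  have \<delta>_le: "\<delta> \<le> dist x y" if "j \<in> J" "k \<in> J" "j \<noteq> k" "x \<in> f j ` K" "y \<in> f k ` K" for j k x y
  proof -
    have "\<delta> \<le> d j k" unfolding \<delta>_def using fin that by (intro Min_le) auto
    then show ?thesis using d[OF that(1-3)] that by force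
  qed
  have zero: "1 \<le> (\<Sum>i\<in>I. diam_pow s (U i))" if "s = 0" "finite I" "K \<subseteq> (\<Union>i\<in>I. U i)"
    for I :: "nat set" and U :: "nat \<Rightarrow> 'a set"
  proof -
    have "\<exists>i\<in>I. U i \<noteq> {}" using that(3) K(2) by blast
    then obtain i where i: "i \<in> I" "U i \<noteq> {}" by blast
    then have "1 = diam_pow s (U i)" using that by (simp add: diam_pow_def)
    also have "\<dots> \<le> (\<Sum>i\<in>I. diam_pow s (U i))" using i that by (intro member_le_sum) auto
    finally show ?thesis .
  qed
  txt \<open>A cover by sets of diameter below the gap \<open>\<delta>\<close> splits into covers of the copies by fewer
    sets each; pulling these back to \<open>K\<close> gives an induction on the number of sets.\<close>
  have pos: "ennreal (\<delta> powr s) \<le> (\<Sum>i\<in>I. diam_pow s (U i))"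
    if "0 < s" "finite I" "K \<subseteq> (\<Union>i\<in>I. U i)" for I :: "nat set" and U :: "nat \<Rightarrow> 'a set"
    using that(2,3)
  proof (induction I arbitrary: U rule: finite_psubset_induct)
    case (psubset I)
    show ?case
    proof (cases "\<exists>i\<in>I. \<exists>x\<in>U i. \<exists>y\<in>U i. \<delta> \<le> dist x y")
      case True
      then obtain i x y where i: "i \<in> I" "x \<in> U i" "y \<in> U i" "\<delta> \<le> dist x y" by blast
      then have "ennreal (\<delta> powr s) \<le> diam_pow s (U i)"
        using dist_powr_le_diam_pow \<delta> that(1) by (metis less_imp_le)
      also have "\<dots> \<le> (\<Sum>i\<in>I. diam_pow s (U i))" using i psubset by (intro member_le_sum) auto
      finally show ?thesis .
    next
      case False
      define I' where "I' j = {i\<in>I. U i \<inter> f j ` K \<noteq> {}}" for j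
      have disj': "I' j \<inter> I' k = {}" if "j \<in> J" "k \<in> J" "j \<noteq> k" for j k
        using False \<delta>_le[OF that] unfolding I'_def by blast
      have ne: "I' j \<noteq> {}" if "j \<in> J" for j
        using K(2) sub[OF that] psubset(3) unfolding I'_def by blast
      \<comment> \<open>A single copy would give a sum \<rho>^s < 1. With a second copy present, the
        sets meeting it miss copy \<open>j\<close>, so \<open>I' j\<close> is a proper subset and
        the induction hypothesis applies.\<close>
      have other: "\<exists>k\<in>J. k \<noteq> j" if "j \<in> J" for j
      proof (rule ccontr)
        assume "\<not> ?thesis"
        then have "J = {j}" using that by blast
        then have "1 \<le> \<rho> j powr s" using s by simp
        moreover have "\<rho> j powr s < 1" using powr_less_mono2[of s "\<rho> j" 1] \<rho>[OF that] \<open>0 < s\<close> by simp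
        ultimately show False by simp
      qed
      have less: "I' j \<subset> I" if "j \<in> J" for j
      proof -
        obtain k where k: "k \<in> J" "k \<noteq> j" using other[OF \<open>j \<in> J\<close>] by blast
        obtain i where i: "i \<in> I' k" using ne[OF k(1)] by blast
        moreover have "i \<notin> I' j" using disj'[OF k(1) \<open>j \<in> J\<close> k(2)] i by blast
        moreover have "I' l \<subseteq> I" for l by (auto simp: I'_def)
        ultimately show ?thesis by blast
      qed
      have step: "ennreal (\<rho> j powr s) * ennreal (\<delta> powr s) \<le> (\<Sum>i\<in>I' j. diam_pow s (U i))"
        if j: "j \<in> J" for j
      proof -
        have "K \<subseteq> (\<Union>i\<in>I' j. f j -` U i)"
        proof
          fix x assume "x \<in> K"
          then obtain i where "i \<in> I" "f j x \<in> U i" using psubset(3) sub[OF j] by blast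
          then show "x \<in> (\<Union>i\<in>I' j. f j -` U i)" using \<open>x \<in> K\<close> unfolding I'_def by blast
        qed
        from psubset.IH[OF less[OF j] this]
        have "ennreal (\<rho> j powr s) * ennreal (\<delta> powr s)
            \<le> ennreal (\<rho> j powr s) * (\<Sum>i\<in>I' j. diam_pow s (f j -` U i))"
          by (intro mult_left_mono) auto
        also have "\<dots> = (\<Sum>i\<in>I' j. diam_pow s (f j ` (f j -` U i)))"
          unfolding sum_distrib_left
          using diam_pow_image_similarity[OF sim[OF j] \<rho>(1)[OF j]] by (simp del: image_vimage_eq)
        also have "\<dots> \<le> (\<Sum>i\<in>I' j. diam_pow s (U i))"
          using s by (intro sum_mono diam_pow_mono) auto
        finally show ?thesis .
      qed
      \<comment> \<open>The lower bound 1 on the sum of powers closes the induction: the copies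
        together cost at least the amount claimed for \<open>K\<close>.\<close>
      have "ennreal (\<delta> powr s) \<le> ennreal (\<Sum>j\<in>J. \<rho> j powr s) * ennreal (\<delta> powr s)"
        using mult_right_mono[OF ennreal_leI[OF s(2)], of "ennreal (\<delta> powr s)"] by simp
      also have "\<dots> = (\<Sum>j\<in>J. ennreal (\<rho> j powr s) * ennreal (\<delta> powr s))"
        unfolding sum_distrib_right[symmetric] by simp
      also have "\<dots> \<le> (\<Sum>j\<in>J. \<Sum>i\<in>I' j. diam_pow s (U i))"
        by (intro sum_mono step)
      also have "\<dots> = (\<Sum>i\<in>(\<Union>j\<in>J. I' j). diam_pow s (U i))"
        by (rule sum.UNION_disjoint[symmetric]) (use assms(1) psubset(1) disj' in \<open>auto simp: I'_def\<close>)
      also have "\<dots> \<le> (\<Sum>i\<in>I. diam_pow s (U i))"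
        by (rule sum_mono2) (use psubset(1) in \<open>auto simp: I'_def\<close>)
      finally show ?thesis .
    qed
  qed
  define c where "c = (if s = 0 then 1 else ennreal (\<delta> powr s))"
  have "c \<le> (\<Sum>i\<in>I. diam_pow s (U i))" if "finite I" "K \<subseteq> (\<Union>i\<in>I. U i)"
    for I :: "nat set" and U :: "nat \<Rightarrow> 'a set"
    using zero pos that s(1) by (auto simp: c_def)
  then have "\<not> hausdorff_content s K < c"
    using finite_open_cover_of_content_less[OF K(1) s(1)] by (metis linorder_not_less)
  moreover have "0 < c" using \<delta> by (auto simp: c_def)
  ultimately show ?thesis by (metis linorder_not_less order_less_le_trans)
qed

section \<open>Words and the similarity dimension bound\<close>

locale self_similar_set =
  fixes I :: "nat set" and S :: "nat \<Rightarrow> 'a::euclidean_space \<Rightarrow> 'a" and r :: "nat \<Rightarrow> real" and K :: "'a set"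
  assumes ratio_pos: "i \<in> I \<Longrightarrow> 0 < r i"
    and ratio_less_1: "i \<in> I \<Longrightarrow> r i < 1"
    and dist_S: "i \<in> I \<Longrightarrow> dist (S i x) (S i y) = r i * dist x y"
    and finite_I: "finite I"
    and K_ne: "K \<noteq> {}"
    and compact_K: "compact K"
    and K_eq: "K = (\<Union>i\<in>I. S i ` K)"
begin

lemma K_diameter_bound:
  obtains D where "0 < D" and "\<forall>x\<in>K. \<forall>y\<in>K. dist x y \<le> D"
proof -
  have bdd: "bounded K" using compact_K by (rule compact_imp_bounded)
  have "dist x y \<le> diameter K + 1" if "x \<in> K" "y \<in> K" for x y
    using diameter_bounded_bound[OF bdd that] by simp
  then show thesis using that[of "diameter K + 1"] diameter_ge_0[OF bdd] by simp
qed

abbreviation words :: "nat list set" where "words \<equiv> lists I"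

text \<open>The first letter is the outermost map, so appending a suffix to a word gives a piece
  inside the piece of that word.\<close>

primrec word_map :: "nat list \<Rightarrow> 'a \<Rightarrow> 'a" where
  "word_map [] = id"
| "word_map (i # w) = S i \<circ> word_map w"

definition word_ratio :: "nat list \<Rightarrow> real" where
  "word_ratio w = prod_list (map r w)"

lemma word_map_append: "word_map (v @ w) = word_map v \<circ> word_map w"
  by (induction v) auto

lemma word_ratio_simps [simp]: "word_ratio [] = 1" "word_ratio (i # w) = r i * word_ratio w"
  by (simp_all add: word_ratio_def)

lemma word_ratio_append: "word_ratio (v @ w) = word_ratio v * word_ratio w"
  by (simp add: word_ratio_def)

lemma word_ratio_pos: "w \<in> words \<Longrightarrow> 0 < word_ratio w"
  by (induction w) (auto intro!: mult_pos_pos ratio_pos)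

lemma dist_word_map: "w \<in> words \<Longrightarrow> dist (word_map w x) (word_map w y) = word_ratio w * dist x y"
  by (induction w) (auto simp: dist_S)

lemma word_map_K_subset: "w \<in> words \<Longrightarrow> word_map w ` K \<subseteq> K"
proof (induction w)
  case (Cons i w)
  then have "S i ` word_map w ` K \<subseteq> S i ` K" by (intro image_mono) auto
  also have "\<dots> \<subseteq> K" using Cons.prems by (subst (2) K_eq) auto
  finally show ?case by (simp add: image_comp)
qed auto

lemma compact_word_map_K: "w \<in> words \<Longrightarrow> compact (word_map w ` K)"
proof (rule compact_continuous_image[OF _ compact_K])
  assume "w \<in> words"
  then have "(word_ratio w)-lipschitz_on K (word_map w)"
    by (intro lipschitz_onI) (auto simp: dist_word_map word_ratio_pos less_imp_le)
  then show "continuous_on K (word_map w)" by (rule lipschitz_on_continuous_on)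
qed

lemma ex_word_length: "x \<in> K \<Longrightarrow> \<exists>w\<in>words. length w = n \<and> x \<in> word_map w ` K"
proof (induction n arbitrary: x)
  case 0 then show ?case by (intro bexI[of _ "[]"]) auto
next
  case (Suc n)
  obtain i y where i: "i \<in> I" "y \<in> K" "x = S i y" using Suc.prems by (subst (asm) K_eq) auto
  obtain w where w: "w \<in> words" "length w = n" "y \<in> word_map w ` K" using Suc.IH[OF i(2)] by blast
  show ?case using i w by (intro bexI[of _ "i # w"]) auto
qed

definition rmax :: real where "rmax = Max (r ` I)"

lemma I_ne: "I \<noteq> {}"
  using K_ne K_eq by auto

lemma rmax: "0 < rmax" "rmax < 1" "i \<in> I \<Longrightarrow> r i \<le> rmax"
proof -
  have "rmax \<in> r ` I" unfolding rmax_def using I_ne finite_I by (intro Max_in) auto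
  then show "0 < rmax" "rmax < 1" using ratio_pos ratio_less_1 by auto
  show "i \<in> I \<Longrightarrow> r i \<le> rmax" unfolding rmax_def using finite_I by (intro Max_ge) auto
qed

lemma word_ratio_le: "w \<in> words \<Longrightarrow> word_ratio w \<le> rmax ^ length w"
  by (induction w) (auto intro!: mult_mono rmax less_imp_le[OF word_ratio_pos] less_imp_le[OF rmax(1)])

lemma rmax_power_less: assumes "0 < e" obtains n where "\<forall>k\<ge>n. rmax ^ k < e"
proof -
  have "(\<lambda>n. rmax ^ n) \<longlonglongrightarrow> 0" using rmax by (intro LIMSEQ_power_zero) auto
  then have "\<forall>\<^sub>F n in sequentially. rmax ^ n < e" using assms by (rule order_tendstoD)
  then show thesis using that unfolding eventually_sequentially by blast
qed

lemma finite_large_words: assumes "0 < e" shows "finite {w\<in>words. e < word_ratio w}"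
proof -
  obtain n where n: "\<forall>k\<ge>n. rmax ^ k < e" by (rule rmax_power_less[OF assms])
  have "length w \<le> n" if "w \<in> words" "e < word_ratio w" for w
    using word_ratio_le[OF that(1)] spec[OF n, of "length w"] that(2) by linarith
  then have "{w\<in>words. e < word_ratio w} \<subseteq> {w. set w \<subseteq> I \<and> length w \<le> n}" by auto
  then show ?thesis by (rule finite_subset) (rule finite_lists_length_le[OF finite_I])
qed

lemma ex_small_word:
  assumes "x \<in> K" and "0 < e"
  obtains w where "w \<in> words" and "x \<in> word_map w ` K" and "word_ratio w < e"
proof -
  obtain n where n: "\<forall>k\<ge>n. rmax ^ k < e" by (rule rmax_power_less[OF assms(2)])
  obtain w where w: "w \<in> words" "length w = n" "x \<in> word_map w ` K"
    using ex_word_length[OF assms(1)] by blast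
  then have "word_ratio w < e" using word_ratio_le[OF w(1)] spec[OF n, of n] by simp
  then show thesis using that w by blast
qed

text \<open>A sum above 1 at the dimension would, by continuity in the exponent, stay above 1
  slightly beyond it. Exponents of vanishing measure exist arbitrarily close to the infimum, while
  the disjoint copies force positive content there. Excluding the empty word keeps all ratios
  strictly below 1.\<close>

lemma sum_ratio_powr_le_1:
  assumes "hausdorff_dim K < top" and "finite J" and "J \<subseteq> words" and "[] \<notin> J"
    and disj: "\<And>v w. v \<in> J \<Longrightarrow> w \<in> J \<Longrightarrow> v \<noteq> w \<Longrightarrow> word_map v ` K \<inter> word_map w ` K = {}"
  shows "(\<Sum>w\<in>J. word_ratio w powr enn2real (hausdorff_dim K)) \<le> 1"
proof (rule ccontr)
  define t where "t = enn2real (hausdorff_dim K)"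
  assume "\<not> ?thesis"
  then have "1 < (\<Sum>w\<in>J. word_ratio w powr t)" by (simp add: t_def)
  have pos: "0 < word_ratio w" "word_ratio w < 1" if "w \<in> J" for w
  proof -
    show "0 < word_ratio w" using that assms by (auto intro: word_ratio_pos)
    have "w \<noteq> []" using that assms(4) by blast
    then obtain n where n: "length w = Suc n" by (cases w) auto
    have "word_ratio w \<le> rmax ^ Suc n" using word_ratio_le[of w] that assms n by auto
    also have "\<dots> < 1" using rmax by (intro power_Suc_less_one) auto
    finally show "word_ratio w < 1" .
  qed
  have "((\<lambda>s. \<Sum>w\<in>J. word_ratio w powr s) \<longlongrightarrow> (\<Sum>w\<in>J. word_ratio w powr t)) (at_right t)"
    by (intro tendsto_intros) (use pos in force)
  then have "\<forall>\<^sub>F s in at_right t. 1 < (\<Sum>w\<in>J. word_ratio w powr s)"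
    by (rule order_tendstoD) fact
  then obtain b where b: "t < b" "\<And>s. t < s \<Longrightarrow> s < b \<Longrightarrow> 1 < (\<Sum>w\<in>J. word_ratio w powr s)"
    unfolding eventually_at_right_field by blast
  have "hausdorff_dim K = ennreal t" using assms(1) by (simp add: t_def)
  also have "\<dots> < ennreal b" using b by (simp add: t_def ennreal_less_iff)
  finally obtain s where s: "0 \<le> s" "hausdorff_measure s K = 0" "ennreal s < ennreal b"
    unfolding hausdorff_dim_def INF_less_iff by auto
  have "s < b" using s by (simp add: ennreal_less_iff)
  \<comment> \<open>Possibly \<open>s = t\<close>, where the choice of \<open>b\<close> says
    nothing. The exponent \<open>s'\<close> lies strictly between \<open>t\<close> and
    \<open>b\<close> and is at least \<open>s\<close>; going down from \<open>s'\<close> to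
    \<open>s\<close> only increases the sum, since the ratios are below 1.\<close>
  define s' where "s' = (max s t + b) / 2"
  have s': "t < s'" "s \<le> s'" "s' < b" using b \<open>s < b\<close> by (auto simp: s'_def max_def)
  have "1 \<le> (\<Sum>w\<in>J. word_ratio w powr s')" using b(2)[OF s'(1,3)] by simp
  also have "\<dots> \<le> (\<Sum>w\<in>J. word_ratio w powr s)"
    using pos s' by (intro sum_mono powr_mono') (auto intro: less_imp_le)
  finally have "1 \<le> (\<Sum>w\<in>J. word_ratio w powr s)" .
  moreover have "word_map w ` K \<subseteq> K" if "w \<in> J" for w
    using that assms(3) by (intro word_map_K_subset) auto
  moreover have "dist (word_map w x) (word_map w y) = word_ratio w * dist x y" if "w \<in> J" for w x y
    using that assms(3) by (intro dist_word_map) auto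
  ultimately have "0 < hausdorff_content s K"
    using assms(2) s(1) pos disj
    by (intro content_pos_of_disjoint_copies[where J = J and f = word_map and \<rho> = word_ratio] compact_K K_ne)
  also have "\<dots> \<le> hausdorff_measure s K" by (rule hausdorff_content_le_measure)
  finally show False using s by simp
qed

end

section \<open>Vitali selection of pieces with nearly trivial orthogonal part\<close>

text \<open>Vitali's selection as combinatorics: \<open>meets\<close> stands for intersecting pieces
  and \<open>\<rho>\<close> for their ratios. Finiteness above every positive threshold gives true
  maxima, so no factor is lost in comparing sizes.\<close>

lemma greedy_selection:
  fixes \<rho> :: "'i \<Rightarrow> real" and meets :: "'i \<Rightarrow> 'i \<Rightarrow> bool"
  assumes pos: "\<And>w. w \<in> V \<Longrightarrow> 0 < \<rho> w"
    and fin: "\<And>e. 0 < e \<Longrightarrow> finite {w\<in>V. e < \<rho> w}"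
    and refl: "\<And>w. w \<in> V \<Longrightarrow> meets w w"
    and sym: "\<And>v w. meets v w \<Longrightarrow> meets w v"
  obtains F where "F \<subseteq> V" and "\<And>v w. v \<in> F \<Longrightarrow> w \<in> F \<Longrightarrow> v \<noteq> w \<Longrightarrow> \<not> meets v w"
    and "\<And>w. w \<in> V \<Longrightarrow> \<exists>u\<in>F. meets w u \<and> \<rho> w \<le> \<rho> u"
proof -
  txt \<open>The last clause, that an element meeting the family already meets a member at least as
    large, lets Zorn's lemma replace a greedy recursion by decreasing size.\<close>
  define \<A> where "\<A> = {F. F \<subseteq> V \<and> (\<forall>v\<in>F. \<forall>w\<in>F. v \<noteq> w \<longrightarrow> \<not> meets v w) \<and>
     (\<forall>w\<in>V. \<forall>u\<in>F. meets w u \<longrightarrow> (\<exists>u\<in>F. meets w u \<and> \<rho> w \<le> \<rho> u))}"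
  have "\<exists>M\<in>\<A>. \<forall>X\<in>\<A>. M \<subseteq> X \<longrightarrow> X = M"
  proof (rule subset_Zorn')
    fix C assume C: "subset.chain \<A> C"
    have sub: "C \<subseteq> \<A>" and total: "\<And>X Y. X \<in> C \<Longrightarrow> Y \<in> C \<Longrightarrow> X \<subseteq> Y \<or> Y \<subseteq> X"
      using C unfolding subset_chain_def by blast+
    have "\<not> meets v w" if "v \<in> \<Union>C" "w \<in> \<Union>C" "v \<noteq> w" for v w
    proof -
      obtain X where X: "X \<in> C" "v \<in> X" using \<open>v \<in> \<Union>C\<close> by blast
      obtain Y where Y: "Y \<in> C" "w \<in> Y" using \<open>w \<in> \<Union>C\<close> by blast
      note XY = X Y
      then have "X \<union> Y \<in> C" using total[of X Y] by (metis sup.absorb1 sup.absorb2)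
      then have "X \<union> Y \<in> \<A>" using sub by blast
      then show ?thesis using XY that(3) unfolding \<A>_def by blast
    qed
    moreover have "\<exists>u\<in>\<Union>C. meets w u \<and> \<rho> w \<le> \<rho> u" if "w \<in> V" "u \<in> \<Union>C" "meets w u" for w u
    proof -
      obtain X where X: "X \<in> C" "u \<in> X" using \<open>u \<in> \<Union>C\<close> by blast
      then have "X \<in> \<A>" using sub by blast
      then show ?thesis using X that unfolding \<A>_def by blast
    qed
    moreover have "\<Union>C \<subseteq> V" using sub unfolding \<A>_def by blast
    ultimately show "\<Union>C \<in> \<A>" unfolding \<A>_def by blast
  qed
  then obtain M where M: "M \<in> \<A>" "\<And>X. X \<in> \<A> \<Longrightarrow> M \<subseteq> X \<Longrightarrow> X = M" by blast
  have MA: "M \<subseteq> V" "\<And>v w. v \<in> M \<Longrightarrow> w \<in> M \<Longrightarrow> v \<noteq> w \<Longrightarrow> \<not> meets v w"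
    "\<And>w u. w \<in> V \<Longrightarrow> u \<in> M \<Longrightarrow> meets w u \<Longrightarrow> \<exists>u\<in>M. meets w u \<and> \<rho> w \<le> \<rho> u"
    using M(1) unfolding \<A>_def by blast+
  have meeting: "\<exists>u\<in>M. meets w u" if w: "w \<in> V" for w
  proof (rule ccontr)
    assume no: "\<not> ?thesis"
    \<comment> \<open>\<open>X\<close> is finite, so it has a largest element \<open>v\<close>; as
      \<open>v\<close> is at least as large as \<open>w\<close>, it is largest among all elements of
      \<open>V\<close> that miss \<open>M\<close>.\<close>
    define X where "X = {v\<in>V. (\<forall>u\<in>M. \<not> meets v u) \<and> \<rho> w \<le> \<rho> v}"
    have "w \<in> X" using w no by (auto simp: X_def)
    have "finite X"
      using pos[OF w] by (intro finite_subset[OF _ fin[of "\<rho> w / 2"]]) (auto simp: X_def)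
    then have "finite (\<rho> ` X)" "\<rho> ` X \<noteq> {}" using \<open>w \<in> X\<close> by auto
    from Max_in[OF this] obtain v where v: "v \<in> X" "Max (\<rho> ` X) = \<rho> v" by blast
    have big: "\<rho> u \<le> \<rho> v" if "u \<in> V" "\<forall>x\<in>M. \<not> meets u x" for u
    proof (cases "\<rho> w \<le> \<rho> u")
      case True
      then have "u \<in> X" using that by (simp add: X_def)
      then show ?thesis using v \<open>finite (\<rho> ` X)\<close> by (metis Max_ge imageI)
    next
      case False
      then show ?thesis using v(1) by (simp add: X_def)
    qed
    have vV: "v \<in> V" and vM: "\<And>u. u \<in> M \<Longrightarrow> \<not> meets v u" using v(1) by (auto simp: X_def)
    have "\<exists>u\<in>insert v M. meets x u \<and> \<rho> x \<le> \<rho> u" if "x \<in> V" "y \<in> insert v M" "meets x y" for x y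
    proof (cases "\<exists>u\<in>M. meets x u")
      case True
      then show ?thesis using MA(3)[OF that(1)] by blast
    next
      case False
      then show ?thesis using big[OF that(1)] that by blast
    qed
    moreover have "\<not> meets x y" if "x \<in> insert v M" "y \<in> insert v M" "x \<noteq> y" for x y
      using that vM MA(2) sym by blast
    ultimately have "insert v M \<in> \<A>" using vV MA(1) unfolding \<A>_def by blast
    then have "v \<in> M" using M(2) by blast
    then show False using vM refl[OF vV] by blast
  qed
  have "\<exists>u\<in>M. meets w u \<and> \<rho> w \<le> \<rho> u" if "w \<in> V" for w
  proof -
    obtain u where "u \<in> M" "meets w u" using meeting[OF \<open>w \<in> V\<close>] by blast
    then show ?thesis using MA(3) \<open>w \<in> V\<close> by blast
  qed
  then show thesis using that[of M] MA(1,2) by blast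
qed

text \<open>The sum over \<open>G\<close> is within \<open>e\<close> of the supremum of all finite
  sums, so a larger sum over a disjoint \<open>J\<close> would push \<open>G \<union> J\<close>
  above the supremum. This gives small tails without ordering the index set.\<close>

lemma finite_subset_small_tail:
  fixes f :: "'i \<Rightarrow> real"
  assumes bound: "\<And>J. finite J \<Longrightarrow> J \<subseteq> F \<Longrightarrow> sum f J \<le> B" and "0 < e"
  obtains G where "finite G" and "G \<subseteq> F" and "\<And>J. finite J \<Longrightarrow> J \<subseteq> F - G \<Longrightarrow> sum f J \<le> e"
proof -
  define \<S> where "\<S> = sum f ` {J. finite J \<and> J \<subseteq> F}"
  have bdd: "bdd_above \<S>" using bound by (auto simp: \<S>_def intro!: bdd_aboveI[of _ B])
  have "\<S> \<noteq> {}" by (auto simp: \<S>_def)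
  moreover have "Sup \<S> - e < Sup \<S>" using assms by simp
  ultimately obtain G where G: "finite G" "G \<subseteq> F" "Sup \<S> - e < sum f G"
    unfolding \<S>_def using less_cSupD by (smt (verit) image_iff mem_Collect_eq)
  have "sum f J \<le> e" if J: "finite J" "J \<subseteq> F - G" for J
  proof -
    have "sum f (G \<union> J) \<in> \<S>" using G J by (auto simp: \<S>_def)
    then have "sum f (G \<union> J) \<le> Sup \<S>" using bdd by (rule cSup_upper)
    moreover have "sum f (G \<union> J) = sum f G + sum f J"
      using G J by (intro sum.union_disjoint) auto
    ultimately show ?thesis using G by simp
  qed
  then show thesis using that G by blast
qed

section \<open>Orthogonal parts of word maps and their return near the identity\<close>

context self_similar_set
begin

text \<open>The orthogonal factor of \<open>word_map w\<close>. As a bounded linear function it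
  lives in a space where the operator norm is available and bounded sets have compact
  closure.\<close>

definition lin_part :: "nat list \<Rightarrow> 'a \<Rightarrow>\<^sub>L 'a" where
  "lin_part w = Blinfun (\<lambda>x. (word_map w x - word_map w 0) /\<^sub>R word_ratio w)"

text \<open>An isometry fixing the origin is orthogonal, hence linear; this justifies the use of
  \<open>Blinfun\<close>, which is faithful only on bounded linear functions.\<close>

lemma lin_part_apply:
  assumes "w \<in> words"
  shows "lin_part w x = (word_map w x - word_map w 0) /\<^sub>R word_ratio w"
proof -
  have "orthogonal_transformation (\<lambda>x. (word_map w x - word_map w 0) /\<^sub>R word_ratio w)"
    using word_ratio_pos[OF assms] dist_word_map[OF assms]
    by (auto simp: orthogonal_transformation_isometry dist_norm simp flip: scaleR_diff_right)
  then have "linear (\<lambda>x. (word_map w x - word_map w 0) /\<^sub>R word_ratio w)"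
    by (rule orthogonal_transformation_linear)
  then show ?thesis
    unfolding lin_part_def by (simp add: bounded_linear_Blinfun_apply linear_conv_bounded_linear)
qed

lemma word_map_eq: "w \<in> words \<Longrightarrow> word_map w x = word_map w 0 + word_ratio w *\<^sub>R lin_part w x"
  using word_ratio_pos[of w] by (simp add: lin_part_apply)

lemma dist_lin_part: "w \<in> words \<Longrightarrow> dist (lin_part w x) (lin_part w y) = dist x y"
  using word_ratio_pos[of w] dist_word_map[of w x y]
  by (simp add: lin_part_apply dist_norm flip: scaleR_diff_right)

lemma norm_lin_part: "w \<in> words \<Longrightarrow> norm (lin_part w x) = norm x"
  using dist_lin_part[of w x 0] by (simp add: blinfun.zero_right)

lemma lin_part_append:
  assumes "v \<in> words" and "w \<in> words"
  shows "lin_part (v @ w) x = lin_part v (lin_part w x)"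
proof -
  have "word_map (v @ w) x - word_map (v @ w) 0 = word_ratio v *\<^sub>R lin_part v (word_map w x - word_map w 0)"
    unfolding word_map_append comp_def
    by (subst (1 2) word_map_eq[OF assms(1)]) (simp add: blinfun.diff_right scaleR_diff_right)
  also have "\<dots> = (word_ratio v * word_ratio w) *\<^sub>R lin_part v (lin_part w x)"
    by (subst (1) word_map_eq[OF assms(2)]) (simp add: blinfun.scaleR_right)
  finally show ?thesis
    using assms word_ratio_pos[OF assms(1)] word_ratio_pos[OF assms(2)]
    by (subst lin_part_apply) (auto simp: word_ratio_append field_simps)
qed

lemma lin_part_totally_bounded:
  assumes "0 < e"
  obtains k where "finite k" and "\<And>w. w \<in> words \<Longrightarrow> \<exists>c\<in>k. dist c (lin_part w) < e"
proof -
  have "norm (lin_part w) \<le> 1" if "w \<in> words" for w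
    using norm_lin_part[OF that] by (intro norm_blinfun_bound) auto
  then have "bounded (lin_part ` words)"
    by (intro boundedI[of _ 1]) (auto simp del: in_lists_conv_set)
  then have "compact (closure (lin_part ` words))" by simp
  then obtain k where k: "finite k" "closure (lin_part ` words) \<subseteq> (\<Union>x\<in>k. ball x e)"
    using assms unfolding compact_eq_totally_bounded by blast
  have "\<exists>c\<in>k. dist c (lin_part w) < e" if "w \<in> words" for w
  proof -
    have "lin_part w \<in> closure (lin_part ` words)"
      by (rule subsetD[OF closure_subset imageI[OF \<open>w \<in> words\<close>]])
    then have "lin_part w \<in> (\<Union>x\<in>k. ball x e)" using k(2) by (rule rev_subsetD)
    then show ?thesis by simp
  qed
  then show thesis using that k(1) by blast
qed

text \<open>A power of any linear part returns near the identity, since the powers of an isometry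
  stay in a totally bounded set.\<close>

lemma ex_suffix_near_id:
  assumes "0 < e" and u: "u \<in> words"
  shows "\<exists>v\<in>words. \<forall>x. norm (lin_part (u @ v) x - x) \<le> e * norm x"
proof -
  obtain k where k: "finite k" "\<And>w. w \<in> words \<Longrightarrow> \<exists>c\<in>k. dist c (lin_part w) < e / 2"
    using lin_part_totally_bounded[of "e / 2"] assms(1) by auto
  define p where "p n = concat (replicate n u)" for n
  have p: "p n \<in> words" for n using u by (induction n) (auto simp: p_def)
  have p_add: "p (a + b) = p a @ p b" for a b by (simp add: p_def replicate_add)
  obtain c where c: "\<And>n. c n \<in> k" "\<And>n. dist (c n) (lin_part (p n)) < e / 2"
    using k(2)[OF p] by metis
  \<comment> \<open>Pigeonhole: infinitely many powers of \<open>u\<close> share finitely many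
    centres, so two of them have linear parts within \<open>e\<close> of each other.\<close>
  have "finite (range c)" using c(1) k(1) by (meson finite_subset image_subsetI)
  then have "\<not> inj c" using finite_imageD infinite_UNIV_nat by blast
  then obtain a b where ab: "a < b" "c a = c b"
    unfolding inj_def by (metis linorder_neqE_nat)
  \<comment> \<open>One copy of \<open>u\<close> is split off the \<open>b - a\<close> additional
    ones, leaving \<open>p q\<close> as the suffix; \<open>q\<close> may be 0.\<close>
  define q where "q = b - a - 1"
  have "dist (lin_part (p b)) (lin_part (p a)) < e"
    using c(2)[of a] c(2)[of b] ab(2) by (metis dist_commute dist_triangle_half_r)
  then have norm: "norm (lin_part (p b) - lin_part (p a)) \<le> e" by (simp add: dist_norm)
  have pb: "p b = p a @ (u @ p q)"
  proof -
    have "b = a + (1 + q)" using ab by (simp add: q_def)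
    then have "p b = p a @ (p 1 @ p q)" by (metis p_add)
    then show ?thesis by (simp add: p_def)
  qed
  then have "norm (lin_part (u @ p q) x - x) \<le> e * norm x" for x
  proof -
    have "norm (lin_part (u @ p q) x - x) = norm (lin_part (p b) x - lin_part (p a) x)"
      using dist_lin_part[OF p, of a "lin_part (u @ p q) x" x] p u
      by (simp add: pb lin_part_append dist_norm)
    also have "\<dots> \<le> norm (lin_part (p b) - lin_part (p a)) * norm x"
      by (metis blinfun.diff_left norm_blinfun)
    also have "\<dots> \<le> e * norm x" using norm by (rule mult_right_mono) simp
    finally show ?thesis .
  qed
  then show ?thesis using p by blast
qed

text \<open>One suffix per ball of a finite net of linear parts suffices: half of \<open>e\<close>
  is spent on replacing \<open>w\<close> by a representative \<open>u\<close> of its ball, half on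
  the suffix of \<open>u\<close>. Finiteness of \<open>Q\<close> later bounds the ratios of the
  suffixes away from 0.\<close>

lemma ex_finite_suffixes_near_id:
  assumes "0 < e"
  obtains Q where "finite Q" and "Q \<subseteq> words"
    and "\<forall>w\<in>words. \<exists>v\<in>Q. \<forall>x. norm (lin_part (w @ v) x - x) \<le> e * norm x"
proof -
  obtain k where k: "finite k" "\<And>w. w \<in> words \<Longrightarrow> \<exists>c\<in>k. dist c (lin_part w) < e / 4"
    using lin_part_totally_bounded[of "e / 4"] assms(1) by auto
  have "0 < e / 2" using assms by simp
  then obtain f where f: "\<And>u. u \<in> words \<Longrightarrow> f u \<in> words"
      "\<And>u x. u \<in> words \<Longrightarrow> norm (lin_part (u @ f u) x - x) \<le> e / 2 * norm x"
    using ex_suffix_near_id by metis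
  define g where "g c = (SOME u. u \<in> words \<and> dist c (lin_part u) < e / 4)" for c
  have g: "g c \<in> words \<and> dist c (lin_part (g c)) < e / 4" if "w \<in> words" "dist c (lin_part w) < e / 4" for c w
    unfolding g_def by (rule someI[of _ w]) (use that in simp)
  define Q where "Q = f ` g ` {c\<in>k. g c \<in> words}"
  have "\<exists>v\<in>Q. \<forall>x. norm (lin_part (w @ v) x - x) \<le> e * norm x" if w: "w \<in> words" for w
  proof -
    obtain c where c: "c \<in> k" "dist c (lin_part w) < e / 4" using k(2)[OF w] by blast
    define u where "u = g c"
    have u: "u \<in> words" "dist c (lin_part u) < e / 4" using g[OF w c(2)] by (auto simp: u_def)
    have "dist (lin_part w) (lin_part u) < e / 2"
      using c(2) u(2) dist_triangle2[of "lin_part w" "lin_part u" c]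
      by (simp add: dist_commute)
    then have wu: "norm (lin_part w - lin_part u) \<le> e / 2" by (simp add: dist_norm)
    have "norm (lin_part (w @ f u) x - x) \<le> e * norm x" for x
    proof -
      let ?y = "lin_part (f u) x"
      have "norm (lin_part w ?y - lin_part u ?y) \<le> norm (lin_part w - lin_part u) * norm ?y"
        by (metis blinfun.diff_left norm_blinfun)
      also have "\<dots> = norm (lin_part w - lin_part u) * norm x"
        using norm_lin_part[OF f(1)[OF u(1)]] by simp
      also have "\<dots> \<le> e / 2 * norm x" using wu by (rule mult_right_mono) simp
      finally have "norm (lin_part w ?y - lin_part u ?y) \<le> e / 2 * norm x" .
      moreover have "norm (lin_part u ?y - x) \<le> e / 2 * norm x"
        using f(2)[OF u(1)] lin_part_append[OF u(1) f(1)[OF u(1)]] by simp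
      moreover have "norm (lin_part w ?y - x) \<le> norm (lin_part w ?y - lin_part u ?y) + norm (lin_part u ?y - x)"
        by (metis norm_triangle_ineq diff_add_cancel add_diff_eq)
      ultimately show ?thesis using lin_part_append[OF w f(1)[OF u(1)]] by simp
    qed
    moreover have "f u \<in> Q" using c(1) u(1) by (auto simp: Q_def u_def)
    ultimately show ?thesis by blast
  qed
  moreover have "finite Q" "Q \<subseteq> words" using k(1) f(1) by (auto simp: Q_def)
  ultimately show thesis using that by blast
qed

section \<open>Vitali covering by small pieces with nearly trivial rotation\<close>

definition near_id_words :: "real \<Rightarrow> real \<Rightarrow> nat list set" where
  "near_id_words e \<eta> =
     {w\<in>words. word_ratio w < \<eta> \<and> (\<forall>x. norm (lin_part w x - x) \<le> e * norm x)}"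

text \<open>The second clause is the covering statement behind Vitali's theorem, before any measure
  enters: whichever finite part \<open>G\<close> is kept, enlarged balls at the other pieces cover
  the rest, with one \<open>C\<close> for all \<open>G\<close> and all base points.\<close>

definition vitali_family :: "real \<Rightarrow> nat list set \<Rightarrow> bool" where
  "vitali_family C F \<longleftrightarrow>
     (\<forall>v\<in>F. \<forall>w\<in>F. v \<noteq> w \<longrightarrow> word_map v ` K \<inter> word_map w ` K = {}) \<and>
     (\<forall>G\<subseteq>F. finite G \<longrightarrow> (\<forall>x0\<in>K. K \<subseteq> (\<Union>w\<in>G. word_map w ` K) \<union>
        (\<Union>w\<in>F - G. cball (word_map w x0) (C * word_ratio w))))"

text \<open>A point outside the kept pieces has a ball missing them, and a tiny piece around the
  point lies in that ball. With a suffix from \<open>Q\<close> it becomes admissible and meets a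
  selected piece at least as large, which cannot be a kept one. Since only finitely many suffixes
  occur, \<open>C\<close> does not depend on \<open>\<eta>\<close>, and \<open>\<eta>\<close> can
  later be chosen in terms of \<open>C\<close>.\<close>

lemma vitali_covering_words:
  assumes "0 < e"
  obtains C where "0 < C" and
    "\<And>\<eta>. 0 < \<eta> \<Longrightarrow> \<exists>F\<subseteq>near_id_words e \<eta>. vitali_family C F"
proof -
  obtain Q where Q: "finite Q" "Q \<subseteq> words"
    "\<forall>w\<in>words. \<exists>v\<in>Q. \<forall>x. norm (lin_part (w @ v) x - x) \<le> e * norm x"
    by (rule ex_finite_suffixes_near_id[OF assms])
  obtain D where D: "0 < D" "\<And>x y. x \<in> K \<Longrightarrow> y \<in> K \<Longrightarrow> dist x y \<le> D"
    using K_diameter_bound by metis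
  define c where "c = Min (insert 1 (word_ratio ` Q))"
  have c: "0 < c" "\<And>v. v \<in> Q \<Longrightarrow> c \<le> word_ratio v"
  proof -
    have "0 < word_ratio v" if "v \<in> Q" for v using that Q(2) word_ratio_pos by blast
    then show "0 < c" using Q(1) by (simp add: c_def)
    show "c \<le> word_ratio v" if "v \<in> Q" for v using that Q(1) by (simp add: c_def)
  qed
  \<comment> \<open>\<open>D / c\<close> accounts for the distance from the point to the selected
    piece, bounded by the size of the tiny piece before its suffix; \<open>D\<close> accounts for
    the diameter of the selected piece.\<close>
  define C where "C = D / c + D"
  have "0 < C" using D c by (simp add: C_def add_pos_pos)
  moreover have "\<exists>F\<subseteq>near_id_words e \<eta>. vitali_family C F" if "0 < \<eta>" for \<eta>
  proof -
    define V where "V = near_id_words e \<eta>"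
    have V: "V \<subseteq> words" by (auto simp: V_def near_id_words_def)
    define meets where "meets v w \<longleftrightarrow> word_map v ` K \<inter> word_map w ` K \<noteq> {}" for v w
    obtain F where F: "F \<subseteq> V" "\<And>v w. v \<in> F \<Longrightarrow> w \<in> F \<Longrightarrow> v \<noteq> w \<Longrightarrow> \<not> meets v w"
        "\<And>w. w \<in> V \<Longrightarrow> \<exists>u\<in>F. meets w u \<and> word_ratio w \<le> word_ratio u"
    proof (rule greedy_selection[of V word_ratio meets])
      show "0 < word_ratio w" if "w \<in> V" for w using that V word_ratio_pos by blast
      show "finite {w\<in>V. \<epsilon> < word_ratio w}" if "0 < \<epsilon>" for \<epsilon>
        by (rule finite_subset[OF _ finite_large_words[OF that]]) (use V in auto)
      show "meets w w" for w using K_ne by (simp add: meets_def)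
      show "meets w v" if "meets v w" for v w using that by (auto simp: meets_def)
    qed (use that in blast)
    have "x \<in> (\<Union>w\<in>G. word_map w ` K) \<union> (\<Union>w\<in>F - G. cball (word_map w x0) (C * word_ratio w))"
      if G: "G \<subseteq> F" "finite G" and x: "x \<in> K" and x0: "x0 \<in> K" for G x x0
    proof (cases "x \<in> (\<Union>w\<in>G. word_map w ` K)")
      case False
      have "closed (\<Union>w\<in>G. word_map w ` K)"
        using G F(1) V by (intro closed_UN ballI compact_imp_closed compact_word_map_K) blast+
      then have "open (- (\<Union>w\<in>G. word_map w ` K))" by (rule open_Compl)
      then obtain \<rho> where \<rho>: "0 < \<rho>" "ball x \<rho> \<subseteq> - (\<Union>w\<in>G. word_map w ` K)"
        using False open_contains_ball by (metis ComplI)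
      have "0 < min (\<rho> / D) \<eta>" using \<rho> D \<open>0 < \<eta>\<close> by simp
      then obtain w where w: "w \<in> words" "x \<in> word_map w ` K" "word_ratio w < min (\<rho> / D) \<eta>"
        using ex_small_word[OF x] by blast
      obtain v where v: "v \<in> Q" "\<And>x. norm (lin_part (w @ v) x - x) \<le> e * norm x"
        using Q(3) w(1) by blast
      have vw: "v \<in> words" using v(1) Q(2) by blast
      have wv: "w @ v \<in> words" using w(1) vw by simp
      have "word_ratio v \<le> 1"
        using word_ratio_le[OF vw] power_le_one[of rmax "length v"] rmax by linarith
      then have "word_ratio (w @ v) \<le> word_ratio w"
        using word_ratio_pos[OF w(1)] by (simp add: word_ratio_append)
      then have "w @ v \<in> V" using w wv v(2) by (auto simp: V_def near_id_words_def)
      then obtain u where u: "u \<in> F" "meets (w @ v) u" "word_ratio (w @ v) \<le> word_ratio u"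
        using F(3) by blast
      then have uw: "u \<in> words" using F(1) V by blast
      obtain z where z: "z \<in> word_map (w @ v) ` K" "z \<in> word_map u ` K"
        using u(2) unfolding meets_def by blast
      have "z \<in> word_map w ` K"
        using z(1) word_map_K_subset[OF vw] by (auto simp: word_map_append)
      then obtain y y' where y: "y \<in> K" "z = word_map w y" "y' \<in> K" "x = word_map w y'" using w(2) by blast
      have xz: "dist x z \<le> word_ratio w * D"
        using y D(2)[of y' y] word_ratio_pos[OF w(1)] by (simp add: dist_word_map[OF w(1)])
      also have "\<dots> < \<rho>" using w(3) D(1) by (simp add: pos_less_divide_eq)
      finally have "z \<in> ball x \<rho>" by simp
      then have "u \<notin> G" using z(2) \<rho>(2) by blast
      have "word_ratio w * c \<le> word_ratio (w @ v)"
        using c(2)[OF v(1)] word_ratio_pos[OF w(1)] by (simp add: word_ratio_append)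
      then have "word_ratio w \<le> word_ratio u / c"
        using u(3) c(1) by (simp add: pos_le_divide_eq)
      then have "word_ratio w * D \<le> word_ratio u / c * D"
        using D(1) by (intro mult_right_mono) auto
      moreover have "dist z (word_map u x0) \<le> word_ratio u * D"
        using z(2) D(2)[OF _ x0] word_ratio_pos[OF uw] by (auto simp: dist_word_map[OF uw])
      moreover have "dist x (word_map u x0) \<le> dist x z + dist z (word_map u x0)" by (rule dist_triangle)
      ultimately have "dist x (word_map u x0) \<le> C * word_ratio u"
        using xz by (simp add: C_def algebra_simps)
      then show ?thesis using \<open>u \<notin> G\<close> u(1) by (auto simp: dist_commute)
    qed simp
    then have cover: "\<forall>G\<subseteq>F. finite G \<longrightarrow> (\<forall>x0\<in>K. K \<subseteq> (\<Union>w\<in>G. word_map w ` K) \<union>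
          (\<Union>w\<in>F - G. cball (word_map w x0) (C * word_ratio w)))"
      by (intro allI impI ballI subsetI)
    have disj: "\<forall>v\<in>F. \<forall>w\<in>F. v \<noteq> w \<longrightarrow> word_map v ` K \<inter> word_map w ` K = {}"
      using F(2) unfolding meets_def by blast
    have "vitali_family C F" unfolding vitali_family_def using disj cover by (rule conjI)
    then show ?thesis using F(1) unfolding V_def by blast
  qed
  ultimately show thesis by (rule that)
qed

end

section \<open>Measure and content of linear images\<close>

text \<open>The margin \<open>\<kappa>\<close> keeps one open cover valid both when \<open>x\<close>
  is moved by a nearly trivial rotation and when \<open>L\<close> is replaced by a nearby
  map.\<close>

lemma compact_image_thickening:
  assumes "compact K" and "continuous_on K L" and "L ` K \<subseteq> (\<Union>i\<in>J. U i)" and "\<And>i. i \<in> J \<Longrightarrow> open (U i)"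
  obtains \<kappa> where "0 < \<kappa>" and "\<forall>x\<in>K. \<forall>y. dist (L x) y < \<kappa> \<longrightarrow> y \<in> (\<Union>i\<in>J. U i)"
proof -
  have "compact (L ` K)" using assms(2,1) by (rule compact_continuous_image)
  moreover have "open (\<Union>i\<in>J. U i)" using assms(4) by blast
  ultimately obtain \<kappa> where "0 < \<kappa>" "(\<Union>y\<in>L ` K. ball y \<kappa>) \<subseteq> (\<Union>i\<in>J. U i)"
    using assms(3) by (rule compact_subset_open_imp_ball_epsilon_subset)
  then show thesis by (intro that[of \<kappa>] ballI allI impI) (auto simp: subset_eq)
qed

section \<open>Dimension of the attractor and comparison of measure with content\<close>

context self_similar_set
begin

text \<open>There are N^n words of length n, with pieces of diameter at most rmax^n D, so an
  exponent \<open>s\<close> with N rmax^s \<le> 1/2 has vanishing measure. Thus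
  \<open>enn2real\<close> returns the true dimension.\<close>

lemma hausdorff_dim_finite: "hausdorff_dim K < top"
proof -
  obtain D where D: "0 < D" "\<And>x y. x \<in> K \<Longrightarrow> y \<in> K \<Longrightarrow> dist x y \<le> D"
    using K_diameter_bound by metis
  define N where "N = real (card I)"
  have "0 < N" using I_ne finite_I by (simp add: N_def card_gt_0_iff)
  then obtain k where k: "\<forall>j\<ge>k. rmax ^ j < 1 / (2 * N)"
    using rmax_power_less[of "1 / (2 * N)"] by auto
  define s where "s = real (Suc k)"
  have "0 < s" by (simp add: s_def)
  have "rmax powr s = rmax ^ Suc k"
    using rmax(1) by (simp only: s_def powr_realpow)
  also have "\<dots> < 1 / (2 * N)" using k le_SucI by blast
  finally have Ns: "N * rmax powr s \<le> 1 / 2" using \<open>0 < N\<close> by (simp add: field_simps)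
  have pre: "hausdorff_pre s \<eta> K \<le> ennreal ((1/2) ^ n * D powr s)"
    if \<eta>: "ennreal (rmax ^ n * D) \<le> \<eta>" for \<eta> n
  proof (rule hausdorff_pre_le_of_finite_sums)
    let ?W = "{w. set w \<subseteq> I \<and> length w = n}"
    have W: "finite ?W" "?W \<subseteq> words" using finite_lists_length_eq[OF finite_I] by auto
    show "countable ?W" using W(1) by (rule countable_finite)
    show "K \<subseteq> (\<Union>w\<in>?W. word_map w ` K)"
      using ex_word_length[of _ n] by fastforce
    have ediam: "ediam (word_map w ` K) \<le> ennreal (rmax ^ n * D)" if "w \<in> ?W" for w
      unfolding ediam_le_iff
    proof safe
      fix x y assume "x \<in> K" "y \<in> K"
      have w: "w \<in> words" "length w = n" using that by auto
      show "ennreal (dist (word_map w x) (word_map w y)) \<le> ennreal (rmax ^ n * D)"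
        using D(2)[OF \<open>x \<in> K\<close> \<open>y \<in> K\<close>] word_ratio_le[OF w(1)] word_ratio_pos[OF w(1)] rmax(1) w(2)
        by (intro ennreal_leI) (simp only: dist_word_map[OF w(1)], intro mult_mono, auto)
    qed
    show "ediam (word_map w ` K) \<le> \<eta>" if "w \<in> ?W" for w
      using ediam[OF that] \<eta> by (rule order_trans)
    fix J assume J: "finite J" "J \<subseteq> ?W"
    have "(\<Sum>w\<in>J. diam_pow s (word_map w ` K)) \<le> (\<Sum>w\<in>?W. diam_pow s (word_map w ` K))"
      by (rule sum_mono2) (use J W in auto)
    also have "\<dots> \<le> (\<Sum>w\<in>?W. ennreal ((rmax ^ n * D) powr s))"
      using ediam \<open>0 < s\<close> D(1) rmax(1) by (intro sum_mono diam_pow_le) auto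
    also have "\<dots> = ennreal (N ^ n * (rmax ^ n * D) powr s)"
      using card_lists_length_eq[OF finite_I, of n]
      by (simp add: N_def ennreal_mult ennreal_of_nat_eq_real_of_nat)
    also have "N ^ n * (rmax ^ n * D) powr s = (N * rmax powr s) ^ n * D powr s"
    proof -
      have "(rmax ^ n) powr s = (rmax powr s) ^ n"
        using rmax(1) by (simp add: powr_powr mult.commute flip: powr_realpow)
      then show ?thesis using rmax(1) D(1) by (simp add: powr_mult power_mult_distrib)
    qed
    also have "ennreal \<dots> \<le> ennreal ((1/2) ^ n * D powr s)"
      using Ns \<open>0 < N\<close> by (intro ennreal_leI mult_right_mono power_mono) auto
    finally show "(\<Sum>w\<in>J. diam_pow s (word_map w ` K)) \<le> ennreal ((1/2) ^ n * D powr s)" .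
  qed
  have "hausdorff_pre s \<eta> K \<le> 0" if "0 < \<eta>" for \<eta>
  proof (rule ennreal_le_epsilon)
    fix \<epsilon> :: real assume "0 < \<epsilon>"
    have "(\<lambda>n. ennreal (rmax ^ n * D)) \<longlonglongrightarrow> ennreal (0 * D)"
      using rmax by (intro tendsto_intros LIMSEQ_power_zero) auto
    then have "\<forall>\<^sub>F n in sequentially. ennreal (rmax ^ n * D) < \<eta>"
      using \<open>0 < \<eta>\<close> by (intro order_tendstoD) auto
    moreover have "(\<lambda>n. (1/2) ^ n * D powr s) \<longlonglongrightarrow> 0 * D powr s"
      by (intro tendsto_intros LIMSEQ_power_zero) auto
    then have "\<forall>\<^sub>F n in sequentially. (1/2) ^ n * D powr s < \<epsilon>"
      using \<open>0 < \<epsilon>\<close> by (intro order_tendstoD) auto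
    ultimately have "\<forall>\<^sub>F n in sequentially. hausdorff_pre s \<eta> K \<le> ennreal \<epsilon>"
      by eventually_elim (meson pre ennreal_leI less_imp_le order_trans)
    then show "hausdorff_pre s \<eta> K \<le> 0 + ennreal \<epsilon>" by simp
  qed
  then have "hausdorff_measure s K \<le> 0"
    unfolding hausdorff_measure_eq_SUP by (intro SUP_least) simp
  then have "hausdorff_dim K \<le> ennreal s"
    unfolding hausdorff_dim_def using \<open>0 < s\<close> by (intro INF_lower) simp
  then show ?thesis by (rule le_less_trans) simp
qed

text \<open>At exponent 0 every word contributes 1, so two disjoint pieces, containing
  \<open>x\<close> and \<open>y\<close>, would give the sum 2 instead of at most 1.\<close>

lemma hausdorff_dim_pos:
  assumes "x \<in> K" and "y \<in> K" and "x \<noteq> y"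
  shows "0 < enn2real (hausdorff_dim K)"
proof (rule ccontr)
  assume "\<not> ?thesis"
  then have zero: "enn2real (hausdorff_dim K) = 0"
    using enn2real_nonneg[of "hausdorff_dim K"] by linarith
  obtain D where D: "0 < D" "\<And>x y. x \<in> K \<Longrightarrow> y \<in> K \<Longrightarrow> dist x y \<le> D"
    using K_diameter_bound by metis
  \<comment> \<open>The second bound makes the pieces shorter than half the distance from
    \<open>x\<close> to \<open>y\<close>, hence disjoint; the bound 1 excludes the empty word, whose
    ratio is 1.\<close>
  define e where "e = min 1 (dist x y / (2 * D))"
  have "0 < e" using D assms by (simp add: e_def)
  obtain v where v: "v \<in> words" "x \<in> word_map v ` K" "word_ratio v < e"
    by (rule ex_small_word[OF assms(1) \<open>0 < e\<close>])
  obtain w where w: "w \<in> words" "y \<in> word_map w ` K" "word_ratio w < e"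
    by (rule ex_small_word[OF assms(2) \<open>0 < e\<close>])
  have near: "dist p q < dist x y / 2"
    if u: "u \<in> words" "word_ratio u < e" "p \<in> word_map u ` K" "q \<in> word_map u ` K" for u p q
  proof -
    have "dist p q \<le> word_ratio u * D"
      using u(3,4) D(2) word_ratio_pos[OF u(1)] by (auto simp: dist_word_map[OF u(1)])
    also have "\<dots> < dist x y / (2 * D) * D"
      using u(2) D(1) by (intro mult_strict_right_mono) (auto simp: e_def)
    finally show ?thesis using D(1) by simp
  qed
  have disj: "word_map v ` K \<inter> word_map w ` K = {}"
  proof (rule ccontr)
    assume "\<not> ?thesis"
    then obtain z where "z \<in> word_map v ` K" "z \<in> word_map w ` K" by blast
    then have "dist x z < dist x y / 2" "dist z y < dist x y / 2"
      using near v w by blast+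
    then show False using dist_triangle[of x y z] by linarith
  qed
  then have "v \<noteq> w" using v by blast
  moreover have "v \<noteq> []" "w \<noteq> []" using v w by (auto simp: e_def)
  ultimately have "(\<Sum>u\<in>{v, w}. word_ratio u powr enn2real (hausdorff_dim K)) \<le> 1"
    using v w disj by (intro sum_ratio_powr_le_1 hausdorff_dim_finite) auto
  then show False
    using \<open>v \<noteq> w\<close> word_ratio_pos[OF v(1)] word_ratio_pos[OF w(1)] by (simp add: zero)
qed

text \<open>The cover, the margin \<open>\<kappa>\<close> and the constant \<open>C\<close> are
  fixed before \<open>\<eta>\<close>; only \<open>F\<close> and its finite part \<open>G\<close>
  depend on \<open>\<eta>\<close> and the error. Positivity of \<open>t\<close> makes sets of
  infinite diameter infinitely expensive, so the cover can be scaled down to any size.\<close>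

lemma measure_le_content_linear_image:
  fixes L :: "'a \<Rightarrow> 'b::euclidean_space"
  assumes "linear L" and t: "t = enn2real (hausdorff_dim K)" "0 < t"
  shows "hausdorff_measure t (L ` K) \<le> hausdorff_content t (L ` K)"
proof (rule dense_ge)
  fix a assume "hausdorff_content t (L ` K) < a"
  obtain B where B: "0 < B" "\<And>x. norm (L x) \<le> B * norm x"
    by (rule linear_bounded_pos[OF assms(1)]) (rule that)
  have lip: "dist (L x) (L y) \<le> B * dist x y" for x y
    using B(2)[of "x - y"] linear_diff[OF assms(1)] by (simp add: dist_norm)
  have contL: "continuous_on K L" using assms(1) by (simp add: linear_continuous_on linear_conv_bounded_linear)
  then have "compact (L ` K)" using compact_K compact_continuous_image by blast
  then obtain J :: "nat set" and U where J: "finite J" "\<And>i. i \<in> J \<Longrightarrow> open (U i)"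
    "L ` K \<subseteq> (\<Union>i\<in>J. U i)" "(\<Sum>i\<in>J. diam_pow t (U i)) < a"
    using finite_open_cover_of_content_less \<open>hausdorff_content t (L ` K) < a\<close> t(2)
    by (metis less_imp_le)
  obtain \<kappa> where \<kappa>: "0 < \<kappa>" "\<And>x y. x \<in> K \<Longrightarrow> dist (L x) y < \<kappa> \<Longrightarrow> y \<in> (\<Union>i\<in>J. U i)"
    using compact_image_thickening[OF compact_K contL J(3,2)] by metis
  obtain R where R: "0 < R" "\<And>x. x \<in> K \<Longrightarrow> norm x \<le> R"
    using compact_imp_bounded[OF compact_K] bounded_pos by blast
  have fin: "ediam (U i) \<noteq> \<infinity>" if "i \<in> J" for i
  proof
    assume "ediam (U i) = \<infinity>"
    moreover from this have "U i \<noteq> {}" by (auto simp: ediam_empty)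
    ultimately have "diam_pow t (U i) = \<infinity>" using t(2) by (simp add: diam_pow_def)
    moreover have "diam_pow t (U i) \<le> (\<Sum>i\<in>J. diam_pow t (U i))"
      using J(1) that by (intro member_le_sum) auto
    ultimately show False using J(4) by (simp add: top_unique)
  qed
  define M where "M = 1 + (\<Sum>i\<in>J. enn2real (ediam (U i)))"
  have "0 < M" by (simp add: M_def add_pos_nonneg sum_nonneg)
  have M: "ediam (U i) \<le> ennreal M" if "i \<in> J" for i
  proof -
    have "enn2real (ediam (U i)) \<le> (\<Sum>i\<in>J. enn2real (ediam (U i)))"
      using J(1) that by (intro member_le_sum) auto
    then have "ennreal (enn2real (ediam (U i))) \<le> ennreal M" by (intro ennreal_leI) (simp add: M_def)
    then show ?thesis using fin[OF that] by (simp add: less_top)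
  qed
  \<comment> \<open>A linear part within \<open>e\<close> of the identity moves points of
    \<open>K\<close> by at most \<open>e * R\<close>, hence their images under \<open>L\<close> by
    at most \<open>B * e * R = \<kappa> / 2\<close>.\<close>
  define e where "e = \<kappa> / (2 * B * R)"
  have "0 < e" using \<kappa> B R by (simp add: e_def)
  obtain C where C: "0 < C" "\<And>\<eta>. 0 < \<eta> \<Longrightarrow> \<exists>F\<subseteq>near_id_words e \<eta>. vitali_family C F"
    by (rule vitali_covering_words[OF \<open>0 < e\<close>]) (rule that)
  obtain x0 where x0: "x0 \<in> K" using K_ne by blast
  \<comment> \<open>\<open>L\<close> maps a ball of radius \<open>C * word_ratio w\<close> to a set
    of diameter at most \<open>A * word_ratio w\<close>.\<close>
  define A where "A = 2 * C * B"
  have "0 < A" using C(1) B(1) by (simp add: A_def)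
  have "hausdorff_pre t \<eta> (L ` K) \<le> a + ennreal \<epsilon>" if "0 < \<eta>" "0 < \<epsilon>" for \<eta> and \<epsilon> :: real
  proof -
    obtain \<eta>' where \<eta>': "0 < \<eta>'" "ennreal \<eta>' \<le> \<eta>"
      using \<open>0 < \<eta>\<close> by (cases \<eta>) (auto intro: that[of 1])
    \<comment> \<open>The 1 excludes the empty word, \<open>\<eta>' / M\<close> makes the scaled
      covering sets small, and \<open>\<eta>' / A\<close> the images of the balls.\<close>
    define \<eta>0 where "\<eta>0 = min 1 (min (\<eta>' / M) (\<eta>' / A))"
    have "0 < \<eta>0" using \<eta>' \<open>0 < M\<close> \<open>0 < A\<close> by (simp add: \<eta>0_def)
    from C(2)[OF this] obtain F where F: "F \<subseteq> near_id_words e \<eta>0" and vit: "vitali_family C F"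
      by blast
    have disj: "\<And>v w. v \<in> F \<Longrightarrow> w \<in> F \<Longrightarrow> v \<noteq> w \<Longrightarrow> word_map v ` K \<inter> word_map w ` K = {}"
      using vit unfolding vitali_family_def by blast
    have cover: "\<And>G. G \<subseteq> F \<Longrightarrow> finite G \<Longrightarrow> K \<subseteq> (\<Union>w\<in>G. word_map w ` K) \<union>
          (\<Union>w\<in>F - G. cball (word_map w x0) (C * word_ratio w))"
      using vit x0 unfolding vitali_family_def by blast
    have FW: "F \<subseteq> words" using F by (auto simp: near_id_words_def)
    have pos: "0 < word_ratio w" if "w \<in> F" for w using that FW word_ratio_pos by blast
    have small: "word_ratio w < \<eta>0" and near: "norm (lin_part w x - x) \<le> e * norm x" if "w \<in> F" for w x
      using that F by (auto simp: near_id_words_def)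
    have "[] \<notin> F" using small[of "[]"] by (auto simp: \<eta>0_def)
    have sum1: "(\<Sum>w\<in>G. word_ratio w powr t) \<le> 1" if "finite G" "G \<subseteq> F" for G
      unfolding t(1) using that FW disj \<open>[] \<notin> F\<close>
      by (intro sum_ratio_powr_le_1 hausdorff_dim_finite) blast+
    define \<epsilon>' where "\<epsilon>' = \<epsilon> / A powr t"
    have "0 < \<epsilon>'" using \<open>0 < \<epsilon>\<close> \<open>0 < A\<close> by (simp add: \<epsilon>'_def)
    obtain G where G: "finite G" "G \<subseteq> F"
      "\<And>H. finite H \<Longrightarrow> H \<subseteq> F - G \<Longrightarrow> (\<Sum>w\<in>H. word_ratio w powr t) \<le> \<epsilon>'"
      using finite_subset_small_tail[OF sum1 \<open>0 < \<epsilon>'\<close>] by blast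
    define A1 where "A1 = (\<Union>w\<in>G. L ` word_map w ` K)"
    define A2 where "A2 = (\<Union>w\<in>F - G. L ` cball (word_map w x0) (C * word_ratio w))"
    have "L ` K \<subseteq> L ` ((\<Union>w\<in>G. word_map w ` K) \<union>
          (\<Union>w\<in>F - G. cball (word_map w x0) (C * word_ratio w)))"
      by (intro image_mono cover G)
    then have "L ` K \<subseteq> A1 \<union> A2" by (simp add: A1_def A2_def image_Un image_UN)
    then have "hausdorff_pre t \<eta> (L ` K) \<le> hausdorff_pre t \<eta> (A1 \<union> A2)" by (rule hausdorff_pre_mono)
    also have "\<dots> \<le> hausdorff_pre t \<eta> A1 + hausdorff_pre t \<eta> A2" by (rule hausdorff_pre_Un)
    also have "\<dots> \<le> a + ennreal \<epsilon>"
    proof (rule add_mono)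
      \<comment> \<open>\<open>h w\<close> is a similarity of the target space with
        \<open>L (word_map w x) = h w (L (lin_part w x))\<close>. The rotation stays on the source
        side, where it is nearly trivial, so the cover is only scaled and translated.\<close>
      define h where "h w y = L (word_map w 0) + word_ratio w *\<^sub>R y" for w y
      have h: "dist (h w x) (h w y) = word_ratio w * dist x y" if "w \<in> F" for w x y
        using pos[OF that] by (simp add: h_def dist_norm flip: scaleR_diff_right)
      show "hausdorff_pre t \<eta> A1 \<le> a"
      proof (rule hausdorff_pre_le_of_finite_sums[where I = "G \<times> J" and U = "\<lambda>(w, i). h w ` U i"])
        show "countable (G \<times> J)" using G(1) J(1) by (intro countable_finite) auto
        show "A1 \<subseteq> (\<Union>p\<in>G \<times> J. case p of (w, i) \<Rightarrow> h w ` U i)"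
        proof
          fix z assume "z \<in> A1"
          then obtain w x where w: "w \<in> G" "x \<in> K" "z = L (word_map w x)" by (auto simp: A1_def)
          have wF: "w \<in> F" and wW: "w \<in> words" using w(1) G(2) FW by blast+
          have "dist (L x) (L (lin_part w x)) \<le> B * dist x (lin_part w x)" by (rule lip)
          also have "\<dots> \<le> B * (e * R)"
            using near[OF wF, of x] R(2)[OF w(2)] B(1) \<open>0 < e\<close>
            by (intro mult_left_mono) (auto simp: dist_norm norm_minus_commute intro: order_trans mult_left_mono)
          also have "\<dots> < \<kappa>" using \<kappa>(1) B(1) R(1) by (simp add: e_def field_simps)
          finally obtain i where i: "i \<in> J" "L (lin_part w x) \<in> U i" using \<kappa>(2)[OF w(2)] by blast
          have "z = h w (L (lin_part w x))"
            unfolding w(3) h_def by (subst word_map_eq[OF wW]) (simp add: linear_add linear_scale assms(1))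
          then show "z \<in> (\<Union>p\<in>G \<times> J. case p of (w, i) \<Rightarrow> h w ` U i)" using i w(1) by auto
        qed
        show "ediam (case p of (w, i) \<Rightarrow> h w ` U i) \<le> \<eta>" if "p \<in> G \<times> J" for p
        proof -
          obtain w i where p: "p = (w, i)" "w \<in> F" "i \<in> J"
            using \<open>p \<in> G \<times> J\<close> G(2) by blast
          have "ediam (h w ` U i) = ennreal (word_ratio w) * ediam (U i)"
            using h[OF p(2)] pos[OF p(2)] by (intro ediam_image_similarity) auto
          also have "\<dots> \<le> ennreal (word_ratio w) * ennreal M" by (intro mult_left_mono M p) auto
          also have "\<dots> = ennreal (word_ratio w * M)" using pos[OF p(2)] by (simp add: ennreal_mult')
          also have "\<dots> \<le> ennreal \<eta>'"
            using small[OF p(2)] \<open>0 < M\<close> by (intro ennreal_leI) (simp add: \<eta>0_def pos_less_divide_eq)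
          finally show ?thesis using \<eta>'(2) p(1) by simp
        qed
        fix H assume H: "finite H" "H \<subseteq> G \<times> J"
        have "(\<Sum>p\<in>H. diam_pow t (case p of (w, i) \<Rightarrow> h w ` U i))
            \<le> (\<Sum>p\<in>G \<times> J. diam_pow t (case p of (w, i) \<Rightarrow> h w ` U i))"
          using G(1) J(1) H by (intro sum_mono2) auto
        also have "\<dots> = (\<Sum>w\<in>G. \<Sum>i\<in>J. diam_pow t (h w ` U i))"
          by (subst sum.cartesian_product) (simp add: case_prod_unfold)
        also have "\<dots> = (\<Sum>w\<in>G. \<Sum>i\<in>J. ennreal (word_ratio w powr t) * diam_pow t (U i))"
          using G(2) h pos by (intro sum.cong refl diam_pow_image_similarity) auto
        also have "\<dots> = ennreal (\<Sum>w\<in>G. word_ratio w powr t) * (\<Sum>i\<in>J. diam_pow t (U i))"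
          by (simp add: sum_distrib_right flip: sum_distrib_left sum_ennreal)
        also have "\<dots> \<le> 1 * (\<Sum>i\<in>J. diam_pow t (U i))"
          using sum1[OF G(1,2)] by (intro mult_right_mono) auto
        also have "\<dots> \<le> a" using J(4) by simp
        finally show "(\<Sum>p\<in>H. diam_pow t (case p of (w, i) \<Rightarrow> h w ` U i)) \<le> a" .
      qed
      show "hausdorff_pre t \<eta> A2 \<le> ennreal \<epsilon>"
      proof (rule hausdorff_pre_le_of_finite_sums)
        let ?U = "\<lambda>w. L ` cball (word_map w x0) (C * word_ratio w)"
        show "A2 \<subseteq> (\<Union>w\<in>F - G. ?U w)" by (simp add: A2_def)
        show "countable (F - G)" by simp
        have U: "ediam (?U w) \<le> ennreal (A * word_ratio w)" if "w \<in> F" for w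
          unfolding ediam_le_iff
        proof safe
          fix p q assume "p \<in> cball (word_map w x0) (C * word_ratio w)" "q \<in> cball (word_map w x0) (C * word_ratio w)"
          then have "dist p q \<le> 2 * (C * word_ratio w)"
            using dist_triangle2[of p q "word_map w x0"] by (simp add: dist_commute)
          then have "B * dist p q \<le> A * word_ratio w"
            using mult_left_mono[of "dist p q" "2 * (C * word_ratio w)" B] B(1) by (simp add: A_def algebra_simps)
          then show "ennreal (dist (L p) (L q)) \<le> ennreal (A * word_ratio w)"
            using lip[of p q] by (intro ennreal_leI) linarith
        qed
        show "ediam (?U w) \<le> \<eta>" if "w \<in> F - G" for w
        proof -
          have "A * word_ratio w \<le> \<eta>'"
            using small[of w] that \<open>0 < A\<close> by (simp add: \<eta>0_def pos_less_divide_eq mult.commute)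
          then show ?thesis using U[of w] that \<eta>'(2) by (meson DiffD1 ennreal_leI order_trans)
        qed
        fix H assume H: "finite H" "H \<subseteq> F - G"
        have "(\<Sum>w\<in>H. diam_pow t (?U w)) \<le> (\<Sum>w\<in>H. ennreal ((A * word_ratio w) powr t))"
          using H(2) U t(2) \<open>0 < A\<close>
          by (intro sum_mono diam_pow_le mult_nonneg_nonneg less_imp_le[OF pos]) auto
        also have "\<dots> = ennreal (\<Sum>w\<in>H. A powr t * word_ratio w powr t)"
          using \<open>0 < A\<close> pos H by (subst sum_ennreal) (auto intro!: arg_cong[of _ _ ennreal] sum.cong powr_mult less_imp_le)
        also have "\<dots> \<le> ennreal (A powr t * \<epsilon>')"
          unfolding sum_distrib_left[symmetric] using G(3)[OF H] by (intro ennreal_leI mult_left_mono) auto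
        also have "A powr t * \<epsilon>' = \<epsilon>" using \<open>0 < A\<close> by (simp add: \<epsilon>'_def)
        finally show "(\<Sum>w\<in>H. diam_pow t (?U w)) \<le> ennreal \<epsilon>" .
      qed
    qed
    finally show ?thesis .
  qed
  then show "hausdorff_measure t (L ` K) \<le> a"
    unfolding hausdorff_measure_eq_SUP
    by (intro SUP_least, rule ennreal_le_epsilon) simp
qed

end

theorem proposition1p11:
  fixes S :: "nat \<Rightarrow> real^'d \<Rightarrow> real^'d"
    and m :: nat
    and K :: "(real^'d) set"
    and t :: real
    and L :: "real^'d \<Rightarrow> real^'e"
  assumes "ss_ifs m S"
    and "is_attractor m S K"
    and "\<exists>x\<in>K. \<exists>y\<in>K. x \<noteq> y"
    and "t = enn2real (hausdorff_dim K)"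
    and "linear L"
  shows "hausdorff_measure t (L ` K) = hausdorff_content t (L ` K)
    \<and> (\<forall>\<epsilon>::real. \<epsilon> > 0 \<longrightarrow>
         (\<exists>\<delta>::real. \<delta> > 0 \<and>
           (\<forall>L2 :: real^'d \<Rightarrow> real^'e. linear L2 \<longrightarrow> onorm (\<lambda>x. L x - L2 x) < \<delta> \<longrightarrow>
              hausdorff_measure t (L2 ` K) \<le> hausdorff_measure t (L ` K) + ennreal \<epsilon>)))"
proof -
  obtain r where r: "\<And>i. i \<in> {1..m} \<Longrightarrow> 0 < r i \<and> r i < 1 \<and> (\<forall>x y. dist (S i x) (S i y) = r i * dist x y)"
    using assms(1) unfolding ss_ifs_def contracting_similarity_def by metis
  interpret self_similar_set "{1..m}" S r K
    using r assms(2) by unfold_locales (auto simp: is_attractor_def)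
  have "0 < t" using hausdorff_dim_pos assms(3,4) by blast
  \<comment> \<open>Stated for every linear map because the second claim applies it to
    \<open>L2\<close> too: a finite cover bounds only the content of the image under
    \<open>L2\<close>, and this equation turns content into measure.\<close>
  have eq: "hausdorff_measure t (L' ` K) = hausdorff_content t (L' ` K)" if "linear L'"
    for L' :: "real^'d \<Rightarrow> real^'e"
    using measure_le_content_linear_image[OF that assms(4) \<open>0 < t\<close>] hausdorff_content_le_measure
    by (rule order_antisym)
  have "\<exists>\<delta>>0. \<forall>L2 :: real^'d \<Rightarrow> real^'e. linear L2 \<longrightarrow> onorm (\<lambda>x. L x - L2 x) < \<delta> \<longrightarrow>
      hausdorff_measure t (L2 ` K) \<le> hausdorff_measure t (L ` K) + ennreal \<epsilon>" if "0 < \<epsilon>" for \<epsilon>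
  proof (cases "hausdorff_content t (L ` K) = top")
    case True
    then show ?thesis using eq[OF assms(5)] by (intro exI[of _ 1]) auto
  next
    case False
    then have less: "hausdorff_content t (L ` K) < hausdorff_content t (L ` K) + ennreal \<epsilon>"
      using that by (intro less_add_ennreal) (auto simp: less_top)
    have contL: "continuous_on K L"
      using assms(5) by (simp add: linear_continuous_on linear_conv_bounded_linear)
    then have "compact (L ` K)" using compact_K compact_continuous_image by blast
    then obtain J :: "nat set" and U where J: "finite J" "\<And>i. i \<in> J \<Longrightarrow> open (U i)"
      "L ` K \<subseteq> (\<Union>i\<in>J. U i)" "(\<Sum>i\<in>J. diam_pow t (U i)) < hausdorff_content t (L ` K) + ennreal \<epsilon>"
      using finite_open_cover_of_content_less less \<open>0 < t\<close> by (metis less_imp_le)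
    obtain \<kappa> where \<kappa>: "0 < \<kappa>" "\<And>x y. x \<in> K \<Longrightarrow> dist (L x) y < \<kappa> \<Longrightarrow> y \<in> (\<Union>i\<in>J. U i)"
      using compact_image_thickening[OF compact_K contL J(3,2)] by metis
    obtain R where R: "0 < R" "\<And>x. x \<in> K \<Longrightarrow> norm x \<le> R"
      using compact_imp_bounded[OF compact_K] bounded_pos by blast
    have "hausdorff_measure t (L2 ` K) \<le> hausdorff_measure t (L ` K) + ennreal \<epsilon>"
      if L2: "linear L2" "onorm (\<lambda>x. L x - L2 x) < \<kappa> / R" for L2 :: "real^'d \<Rightarrow> real^'e"
    proof -
      have bl: "bounded_linear (\<lambda>x. L x - L2 x)"
        using assms(5) L2(1) by (simp add: linear_compose_sub linear_conv_bounded_linear[symmetric])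
      have "dist (L x) (L2 x) < \<kappa>" if "x \<in> K" for x
      proof -
        have "dist (L x) (L2 x) \<le> onorm (\<lambda>x. L x - L2 x) * norm x"
          using onorm[OF bl] by (simp add: dist_norm)
        also have "\<dots> \<le> onorm (\<lambda>x. L x - L2 x) * R"
          using R(2)[OF that] onorm_pos_le[OF bl] by (rule mult_left_mono)
        also have "\<dots> < \<kappa>" using L2(2) R(1) by (simp add: pos_less_divide_eq)
        finally show ?thesis .
      qed
      then have cover: "L2 ` K \<subseteq> (\<Union>i\<in>J. U i)" using \<kappa>(2) by blast
      have "hausdorff_content t (L2 ` K) \<le> (\<Sum>i\<in>J. diam_pow t (U i))"
        unfolding hausdorff_content_def
        by (rule hausdorff_pre_le_of_finite_sums[OF countable_finite[OF J(1)] cover])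
           (use J(1) in \<open>auto intro: sum_mono2\<close>)
      then show ?thesis using J(4) eq[OF assms(5)] eq[OF L2(1)] by simp
    qed
    then show ?thesis using \<kappa>(1) R(1) by (intro exI[of _ "\<kappa> / R"]) auto
  qed
  then show ?thesis using eq[OF assms(5)] by blast
qed

end
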